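(* Let $N\cong\mathbb{Z}^n$ be a lattice and let $P\subset N_{\mathbb{R}}$ be an $n$-dimensional Fano simplex. Then the following hold. (1) The number of admissible facets of $P$ is invariant under facet mutation: $\mathrm{ad}(\mu_F(P))=\mathrm{ad}(P)$ for every admissible facet $F$ of $P$. In particular, the mutation equivalence class of $P$ carries a canonical exchange graph whose edges correspond to admissible-facet mutations (and whose valency is therefore equal to the number of admissible facets). (2) There exists a weighted Markov-type equation $\mathrm{DE}_P$ associated with $P$ (the one defined in the context) that is invariant under facet mutation: $\mathrm{DE}_Q=\mathrm{DE}_P$ whenever $Q$ is the mutation of $P$ over an admissible facet. Moreover, the set of positive integer solutions of $\mathrm{DE}_P$ carries a canonical exchange graph whose edges correspond to Vieta involutions. (3) One can also associate to each Fano simplex $P$ a distinguished positive integer solution $\mathbf{a}_P$ of $\mathrm{DE}_P$ (the one defined in the context). Moreover, the correspondence $P\mapsto(\mathrm{DE}_P,\mathbf{a}_P)$ is compatible with mutations: if $F_i$ is an admissible facet of $P$ and $Q=\mu_{F_i}(P)$, with the induced labelling, then $(\mathrm{DE}_Q,\mathbf{a}_Q)=(\mathrm{DE}_P,\mu_i(\mathbf{a}_P))$.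
   Context: Let $M=\mathrm{Hom}(N,\mathbb{Z})$, $N_{\mathbb{R}}=N\otimes\mathbb{R}$, $M_{\mathbb{R}}=M\otimes\mathbb{R}$. A lattice polytope $P\subset N_{\mathbb{R}}$ is Fano if it contains the origin in its interior and every vertex is a primitive vector of $N$; a Fano simplex is a Fano polytope that is a simplex of dimension $n=\operatorname{rank}N$. Two polytopes are unimodularly equivalent ($\cong$) if an element of $\mathrm{GL}(N)$ carries one to the other. Admissible facets. For a facet $F$ of $P$, let $n_F\in M$ be the primitive outward normal vector and $d_F\in\mathbb{Z}_{>0}$ the affine distance from the origin, so that $F\subset\{u:\langle n_F,u\rangle=d_F\}$. The facet $F$ is admissible if for a (equivalently, any) vertex $v$ of $F$ there is a lattice polytope $G_{F,v}$ having the origin as a vertex with $F=v+d_F\,G_{F,v}$. The number of admissible facets of $P$ is denoted $\mathrm{ad}(P)$. Facet mutation. Let $F$ be an admissible facet of $P$, $v$ a vertex of $F$, $G=G_{F,v}=\frac{1}{d_F}(F-v)$, $\mathbf{w}_F=-n_F$, $h_{\max}=\max_{x\in P}\langle\mathbf{w}_F,x\rangle$. For an integer $h$ let $S_h=\mathrm{conv}(\{x\in P\cap N:\langle\mathbf{w}_F,x\rangle=h\})$ (possibly empty). The mutation of $P$ over $F$ is $$\mu_F(P)=\mathrm{conv}\Big(\{v\}\cup\bigcup_{h=0}^{h_{\max}}(S_h+hG)\Big).$$ It is again a Fano simplex and, up to unimodular equivalence, does not depend on the choice of $v$. The mutation equivalence class (facet-mutation class) of $P$ is the set of Fano simplices,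 up to unimodular equivalence, obtained from $P$ by finite sequences of mutations over admissible facets. Labelling. Let $v_0,\dots,v_n$ be the vertices of $P$ and $F_i$ the facet opposite $v_i$. If $F_i$ is admissible and $v_r$ ($r\neq i$) is the chosen vertex of $F_i$, then $\mu_{F_i}(P)$ has vertices $v_i'=v_r$, $v_r'=v_i$ and $v_j'=v_i+\frac{h_{\max}}{d_{F_i}}(v_j-v_r)$ for $j\neq i,r$; this is the induced labelling. Markov-type data. Let $\widetilde\lambda_i$ be the index in $N$ of the sublattice spanned by the vertices of $F_i$, let $d=\gcd(\widetilde\lambda_0,\dots,\widetilde\lambda_n)$ be the multiplicity of $P$, and let $\lambda_i=\widetilde\lambda_i/d$ be the weights. Write $\lambda_i=c_ia_i^2$ with $c_i,a_i\in\mathbb{Z}_{>0}$ and $c_i$ square-free, and put $\mathbf{a}_P=(a_0,\dots,a_n)$. Let $k,m$ be the coprime positive integers with $\frac{m}{k}=\frac{c_0a_0^2+\cdots+c_na_n^2}{a_0a_1\cdots a_n}$. The weighted Markov-type equation $\mathrm{DE}_P$ is $$k(c_0x_0^2+c_1x_1^2+\cdots+c_nx_n^2)=m\,x_0x_1\cdots x_n.$$ Vieta involutions. For a positive solution $\mathbf{a}=(a_0,\dots,a_n)$ of this equation and $0\le i\le n$, $\mu_i(\mathbf{a})$ is the tuple obtained from $\mathbf{a}$ by replacing $a_i$ by $a_i'=\frac{\sum_{j\neq i}c_ja_j^2}{c_ia_i}$ and leaving the other entries unchanged; $\mu_i$ is an involution on positive real solutions. Exchange graphs. In (1), the vertices of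 the exchange graph are the Fano simplices (up to unimodular equivalence) in the mutation equivalence class of $P$, and each admissible facet $F$ of a member $R$ gives an edge from $R$ to $\mu_F(R)$. In (2), the vertices are the positive integer solutions of $\mathrm{DE}_P$, and for each such solution $\mathbf{a}$ and each $i\in\{0,\dots,n\}$ the Vieta involution $\mu_i$ gives an edge from $\mathbf{a}$ to $\mu_i(\mathbf{a})$.
   Formalization: In (2), the Vieta involution at index i gives an edge from a positive integer solution a only when μ_i(a) is again integral; as stated this fails, e.g. for x²+y²+3z²=5xyz, where (1,1,1) goes to (1,1,2/3). *)

theory Defs
  imports
    "HOL-Analysis.Analysis"
    "HOL-Computational_Algebra.Squarefree"
    "Graph_Theory.Digraph"
begin

section \<open>Lattices\<close>

text \<open>The ambient type is the real space \<open>N\<^sub>\<real>\<close>; its dimension is the rank \<open>n\<close> of \<open>N\<close>.\<close>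

definition int_span :: "'a::real_vector set \<Rightarrow> 'a set" where
  "int_span S = {\<Sum>x\<in>S. of_int (c x) *\<^sub>R x |c :: 'a \<Rightarrow> int. True}"

definition full_lattice :: "'a::euclidean_space set \<Rightarrow> bool" where
  "full_lattice N \<longleftrightarrow> (\<exists>B. independent B \<and> span B = UNIV \<and> N = int_span B)"

text \<open>\<open>M = Hom(N, \<int>)\<close>: every homomorphism \<open>N \<rightarrow> \<int>\<close> extends uniquely to a linear functional
  on \<open>N\<^sub>\<real>\<close>, and functionals are represented by vectors through the inner product.\<close>

definition dual_lattice :: "'a::euclidean_space set \<Rightarrow> 'a set" where
  "dual_lattice N = {u. \<forall>x\<in>N. u \<bullet> x \<in> \<int>}"

definition primitive_in :: "'a::real_vector set \<Rightarrow> 'a \<Rightarrow> bool" where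
  "primitive_in L x \<longleftrightarrow> x \<in> L \<and> x \<noteq> 0 \<and> (\<forall>y\<in>L. \<forall>k::nat. x = real k *\<^sub>R y \<longrightarrow> k = 1)"

definition GL :: "'a::euclidean_space set \<Rightarrow> ('a \<Rightarrow> 'a) set" where
  "GL N = {g. linear g \<and> bij g \<and> g ` N = N}"

definition lattice_index :: "'a::real_vector set \<Rightarrow> 'a set \<Rightarrow> nat" where
  "lattice_index N L = card (N // {(x, y). x \<in> N \<and> y \<in> N \<and> x - y \<in> L})"

section \<open>Fano simplices\<close>

definition lattice_polytope :: "'a::euclidean_space set \<Rightarrow> 'a set \<Rightarrow> bool" where
  "lattice_polytope N P \<longleftrightarrow> (\<exists>S. finite S \<and> S \<subseteq> N \<and> P = convex hull S)"

definition fano_polytope :: "'a::euclidean_space set \<Rightarrow> 'a set \<Rightarrow> bool" where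
  "fano_polytope N P \<longleftrightarrow> lattice_polytope N P \<and> 0 \<in> interior P \<and>
     (\<forall>v. v extreme_point_of P \<longrightarrow> primitive_in N v)"

definition fano_simplex :: "'a::euclidean_space set \<Rightarrow> 'a set \<Rightarrow> bool" where
  "fano_simplex N P \<longleftrightarrow> fano_polytope N P \<and> int DIM('a) simplex P"

definition unimod_class :: "'a::euclidean_space set \<Rightarrow> 'a set \<Rightarrow> 'a set set" where
  "unimod_class N P = {g ` P |g. g \<in> GL N}"

section \<open>Admissible facets and mutations\<close>

definition facet_normal :: "'a::euclidean_space set \<Rightarrow> 'a set \<Rightarrow> 'a set \<Rightarrow> 'a" where
  "facet_normal N P F = (THE u. primitive_in (dual_lattice N) u \<and>
     (\<exists>c. F \<subseteq> {x. u \<bullet> x = c} \<and> P \<subseteq> {x. u \<bullet> x \<le> c}))"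

definition facet_dist :: "'a::euclidean_space set \<Rightarrow> 'a set \<Rightarrow> 'a set \<Rightarrow> int" where
  "facet_dist N P F = (THE d. \<forall>x\<in>F. facet_normal N P F \<bullet> x = of_int d)"

definition admissible :: "'a::euclidean_space set \<Rightarrow> 'a set \<Rightarrow> 'a set \<Rightarrow> bool" where
  "admissible N P F \<longleftrightarrow> F facet_of P \<and>
     (\<exists>v. v extreme_point_of F \<and>
       (\<exists>G. lattice_polytope N G \<and> 0 extreme_point_of G \<and>
          F = (\<lambda>x. v + of_int (facet_dist N P F) *\<^sub>R x) ` G))"

definition ad :: "'a::euclidean_space set \<Rightarrow> 'a set \<Rightarrow> nat" where
  "ad N P = card {F. admissible N P F}"

definition h_max :: "'a::euclidean_space set \<Rightarrow> 'a set \<Rightarrow> 'a set \<Rightarrow> real" where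
  "h_max N P F = Sup ((\<lambda>x. - facet_normal N P F \<bullet> x) ` P)"

definition facet_mutation :: "'a::euclidean_space set \<Rightarrow> 'a set \<Rightarrow> 'a set \<Rightarrow> 'a \<Rightarrow> 'a set" where
  "facet_mutation N P F v =
     (let w = - facet_normal N P F;
          G = (\<lambda>x. (1 / of_int (facet_dist N P F)) *\<^sub>R (x - v)) ` F;
          S = (\<lambda>h::int. convex hull {x \<in> P \<inter> N. w \<bullet> x = of_int h})
      in convex hull ({v} \<union>
           (\<Union>h\<in>{h. 0 \<le> h \<and> of_int h \<le> h_max N P F}. {s + of_int h *\<^sub>R g |s g. s \<in> S h \<and> g \<in> G})))"

definition mutates_to :: "'a::euclidean_space set \<Rightarrow> 'a set \<Rightarrow> 'a set \<Rightarrow> bool" where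
  "mutates_to N P Q \<longleftrightarrow>
     (\<exists>F v. admissible N P F \<and> v extreme_point_of F \<and> Q = facet_mutation N P F v)"

definition mutation_class :: "'a::euclidean_space set \<Rightarrow> 'a set \<Rightarrow> 'a set set set" where
  "mutation_class N P = {unimod_class N R |R. (mutates_to N)\<^sup>*\<^sup>* P R}"

text \<open>The exchange graph of the mutation class is a multigraph: there is one edge per admissible
  facet of a member, even if several of these edges have the same ends (or are exchanged by an
  automorphism of the member). To have the facets of a class at hand, the
  construction takes a representative \<open>rep C\<close> of each class \<open>C\<close>; the edge of a facet is an arc
  starting at \<open>C\<close>. Its head is the union of the classes of the mutations for all choices
  of the vertex \<open>v\<close>, so it is an equivalence class only if these classes agree.\<close>

definition facet_graph ::
  "'a::euclidean_space set \<Rightarrow> 'a set \<Rightarrow> ('a set set \<Rightarrow> 'a set)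
     \<Rightarrow> ('a set set, 'a set set \<times> 'a set) pre_digraph" where
  "facet_graph N P rep =
     \<lparr> verts = mutation_class N P,
       arcs = {(C, F). C \<in> mutation_class N P \<and> admissible N (rep C) F},
       tail = fst,
       head = (\<lambda>(C, F). \<Union>v\<in>{v. v extreme_point_of F}.
                          unimod_class N (facet_mutation N (rep C) F v)) \<rparr>"

definition same_edges :: "('v, 'e) pre_digraph \<Rightarrow> ('v, 'e) pre_digraph \<Rightarrow> bool" where
  "same_edges G H \<longleftrightarrow> verts G = verts H \<and>
     (\<exists>f. bij_betw f (arcs G) (arcs H) \<and>
        (\<forall>e\<in>arcs G. tail H (f e) = tail G e \<and> head H (f e) = head G e))"

section \<open>Labelled simplices\<close>

text \<open>A simplex with labelled vertices \<open>v\<^sub>0, \<dots>, v\<^sub>n\<close> is given by the list of its vertices.\<close>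

definition labelling :: "'a::euclidean_space set \<Rightarrow> 'a list \<Rightarrow> bool" where
  "labelling P vs \<longleftrightarrow> distinct vs \<and> set vs = {v. v extreme_point_of P}"

definition opp_facet :: "'a::euclidean_space list \<Rightarrow> nat \<Rightarrow> 'a set" where
  "opp_facet vs i = convex hull (set vs - {vs ! i})"

definition induced_labelling ::
  "'a::euclidean_space set \<Rightarrow> 'a set \<Rightarrow> 'a list \<Rightarrow> nat \<Rightarrow> nat \<Rightarrow> 'a list" where
  "induced_labelling N P vs i r =
     (let F = opp_facet vs i; t = h_max N P F / of_int (facet_dist N P F)
      in map (\<lambda>j. if j = i then vs ! r else if j = r then vs ! i
                  else vs ! i + t *\<^sub>R (vs ! j - vs ! r)) [0..<length vs])"

section \<open>Markov-type equations\<close>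

definition facet_index :: "'a::euclidean_space set \<Rightarrow> 'a list \<Rightarrow> nat \<Rightarrow> nat" where
  "facet_index N vs i = lattice_index N (int_span (set vs - {vs ! i}))"

definition simplex_mult :: "'a::euclidean_space set \<Rightarrow> 'a list \<Rightarrow> nat" where
  "simplex_mult N vs = Gcd (facet_index N vs ` {..<length vs})"

definition weight :: "'a::euclidean_space set \<Rightarrow> 'a list \<Rightarrow> nat \<Rightarrow> nat" where
  "weight N vs i = facet_index N vs i div simplex_mult N vs"

definition c_tuple :: "'a::euclidean_space set \<Rightarrow> 'a list \<Rightarrow> nat list" where
  "c_tuple N vs = map (\<lambda>i. squarefree_part (weight N vs i)) [0..<length vs]"

definition a_tuple :: "'a::euclidean_space set \<Rightarrow> 'a list \<Rightarrow> nat list" where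
  "a_tuple N vs = map (\<lambda>i. square_part (weight N vs i)) [0..<length vs]"

text \<open>\<open>(k, m, [c\<^sub>0, \<dots>, c\<^sub>n])\<close> stands for the equation
  \<open>k (c\<^sub>0 x\<^sub>0\<^sup>2 + \<dots> + c\<^sub>n x\<^sub>n\<^sup>2) = m x\<^sub>0 \<dots> x\<^sub>n\<close>.\<close>

type_synonym markov_eq = "nat \<times> nat \<times> nat list"

definition DE :: "'a::euclidean_space set \<Rightarrow> 'a list \<Rightarrow> markov_eq" where
  "DE N vs =
     (let c = c_tuple N vs; a = a_tuple N vs;
          s = (\<Sum>j<length vs. c ! j * (a ! j)\<^sup>2);
          p = (\<Prod>j<length vs. a ! j)
      in (p div gcd s p, s div gcd s p, c))"

fun solves :: "markov_eq \<Rightarrow> real list \<Rightarrow> bool" where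
  "solves (k, m, c) x \<longleftrightarrow> length x = length c \<and>
     real k * (\<Sum>j<length c. real (c ! j) * (x ! j)\<^sup>2) = real m * (\<Prod>j<length c. x ! j)"

definition pos_sols :: "markov_eq \<Rightarrow> real list set" where
  "pos_sols E = {x. solves E x \<and> (\<forall>t\<in>set x. t > 0)}"

definition pos_int_sols :: "markov_eq \<Rightarrow> real list set" where
  "pos_int_sols E = {x \<in> pos_sols E. set x \<subseteq> \<int>}"

fun vieta :: "markov_eq \<Rightarrow> nat \<Rightarrow> real list \<Rightarrow> real list" where
  "vieta (k, m, c) i x =
     x[i := (\<Sum>j\<in>{..<length x} - {i}. real (c ! j) * (x ! j)\<^sup>2) / (real (c ! i) * x ! i)]"

text \<open>The Vieta involutions do not preserve integrality in general: for \<open>x\<^sup>2 + y\<^sup>2 + 3 z\<^sup>2 = 5 x y z\<close>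
  the last one sends \<open>(1, 1, 1)\<close> to \<open>(1, 1, 2/3)\<close>. So there is an edge for \<open>i\<close> at \<open>x\<close> exactly if
  the result is integral again.\<close>

definition solution_graph :: "markov_eq \<Rightarrow> (real list, real list \<times> nat) pre_digraph" where
  "solution_graph E =
     \<lparr> verts = pos_int_sols E,
       arcs = {(x, i). x \<in> pos_int_sols E \<and> i < length x \<and> set (vieta E i x) \<subseteq> \<int>},
       tail = fst,
       head = (\<lambda>(x, i). vieta E i x) \<rparr>"

end

theory Submission
  imports Defs
begin

text \<open>
  Write \<open>v\<^sub>0, \<dots>, v\<^sub>n\<close> for the vertices of a Fano simplex \<open>P\<close> and \<open>0 = \<Sum> \<beta>\<^sub>j v\<^sub>j\<close> for the
  barycentric representation of the origin. Let \<open>F\<close> be the facet opposite \<open>v\<^sub>i\<close>, with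
  primitive normal \<open>n\<close> and distance \<open>d\<close>. Pairing \<open>n\<close> with the representation shows that
  \<open>v\<^sub>i\<close> lies at height \<open>h = t d\<close> on the other side, where \<open>t = (1 - \<beta>\<^sub>i) / \<beta>\<^sub>i\<close>. The facet is
  admissible iff all differences of its vertices lie in \<open>d N\<close>, and then the slices in the
  definition of the mutation fit together to a simplex again: the mutation at \<open>v\<^sub>r\<close> is the
  convex hull of \<open>v\<^sub>r\<close> (the new vertex \<open>i\<close>) and the points \<open>v\<^sub>i + t (v\<^sub>j - v\<^sub>r)\<close> (the new
  vertices \<open>j\<close>); this is \<open>facet_mutation_eq\<close>. All of part (1) is read off from this formula.

  The facet \<open>i\<close> of the mutation has normal \<open>- n\<close> and distance \<open>h\<close>, and a facet \<open>l \<noteq> i, r\<close>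
  keeps both its normal and its distance \<open>d\<^sub>l\<close>. The new facet \<open>i\<close> is admissible because its
  edges are \<open>h / d\<close> times the old ones, and mutating over it gives \<open>P\<close> back. If \<open>v\<^sub>i - v\<^sub>r\<close>
  is in \<open>d\<^sub>l N\<close>, then its height \<open>- (h + d)\<close> is divisible by \<open>d\<^sub>l\<close>, so for \<open>v\<^sub>j - v\<^sub>r = d g\<close> the
  conditions \<open>d g \<in> d\<^sub>l N\<close> before and \<open>h g \<in> d\<^sub>l N\<close> after the mutation agree. The remaining
  facet \<open>l = r\<close> is reached by another choice of \<open>r\<close>, because the shear
  \<open>x \<mapsto> x + \<langle>n, x\<rangle> (v\<^sub>s - v\<^sub>r) / d\<close> carries the mutation at \<open>v\<^sub>r\<close> to the one at \<open>v\<^sub>s\<close>.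
  Together with equivariance under \<open>GL(N)\<close> this yields the exchange graph.

  For parts (2) and (3), the weights are the coprime integers proportional to the \<open>\<beta>\<^sub>j\<close>, since
  the index of the span of a facet is the index of the span of all vertices times the
  weight of the opposite vertex (\<open>facet_index_eq\<close>). The new barycentric coordinates show that the
  weights other than \<open>\<lambda>\<^sub>i\<close> stay the same up to a common factor and that \<open>\<lambda>\<^sub>i\<close> is replaced by
  \<open>\<sigma>\<^sup>2 / \<lambda>\<^sub>i\<close> with \<open>\<sigma> = \<Sum> \<lambda>\<^sub>j\<close> over \<open>j \<noteq> i\<close>. The arithmetic core is that admissibility makes this
  an integer (\<open>weight_dvd_square\<close>), while primitivity of the vertices makes already the
  weights \<open>\<lambda>\<^sub>j\<close> with \<open>j \<noteq> i\<close> coprime (\<open>weight_well_formed\<close>), so that there is no common factor.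
  Finally \<open>\<sigma>\<^sup>2 / (c a\<^sup>2) = c (\<sigma> / (c a))\<^sup>2\<close>: the squarefree part of the weight is unchanged
  and the square part undergoes the Vieta involution, which preserves the equation.
\<close>

section \<open>Lattices and sublattices of finite index\<close>

lemma int_span_eq: "int_span S = {\<Sum>x\<in>S. c x *\<^sub>R x |c. \<forall>x\<in>S. c x \<in> \<int>}"
proof (intro equalityI subsetI)
  fix y assume "y \<in> {\<Sum>x\<in>S. c x *\<^sub>R x |c. \<forall>x\<in>S. c x \<in> \<int>}"
  then obtain c where c: "\<forall>x\<in>S. c x \<in> \<int>" "y = (\<Sum>x\<in>S. c x *\<^sub>R x)" by auto
  have "y = (\<Sum>x\<in>S. of_int \<lfloor>c x\<rfloor> *\<^sub>R x)"
    unfolding c(2) using c(1) by (intro sum.cong) auto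
  then show "y \<in> int_span S" unfolding int_span_def mem_Collect_eq by (intro exI[of _ "\<lambda>x. \<lfloor>c x\<rfloor>"]) simp
qed (auto simp: int_span_def)

lemma int_span_zero: "0 \<in> int_span S"
  unfolding int_span_eq by (auto intro!: exI[of _ "\<lambda>_. 0"])

lemma int_span_add: "x \<in> int_span S \<Longrightarrow> y \<in> int_span S \<Longrightarrow> x + y \<in> int_span S"
  unfolding int_span_eq
proof clarsimp
  fix c d :: "'a \<Rightarrow> real" assume "\<forall>x\<in>S. c x \<in> \<int>" "\<forall>x\<in>S. d x \<in> \<int>"
  then show "\<exists>e. (\<Sum>x\<in>S. c x *\<^sub>R x) + (\<Sum>x\<in>S. d x *\<^sub>R x) = (\<Sum>x\<in>S. e x *\<^sub>R x) \<and> (\<forall>x\<in>S. e x \<in> \<int>)"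
    by (intro exI[of _ "\<lambda>x. c x + d x"]) (auto simp: scaleR_add_left sum.distrib)
qed

lemma int_span_scale: "k \<in> \<int> \<Longrightarrow> x \<in> int_span S \<Longrightarrow> k *\<^sub>R x \<in> int_span S"
  unfolding int_span_eq
proof clarsimp
  fix c :: "'a \<Rightarrow> real" assume "\<forall>x\<in>S. c x \<in> \<int>" "k \<in> \<int>"
  then show "\<exists>e. k *\<^sub>R (\<Sum>x\<in>S. c x *\<^sub>R x) = (\<Sum>x\<in>S. e x *\<^sub>R x) \<and> (\<forall>x\<in>S. e x \<in> \<int>)"
    by (intro exI[of _ "\<lambda>x. k * c x"]) (auto simp: scaleR_sum_right)
qed

lemma int_span_diff: "x \<in> int_span S \<Longrightarrow> y \<in> int_span S \<Longrightarrow> x - y \<in> int_span S"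
  using int_span_add[of x S "- y"] int_span_scale[of "-1" y S] by simp

lemma int_span_sum: "(\<And>a. a \<in> A \<Longrightarrow> f a \<in> int_span S) \<Longrightarrow> sum f A \<in> int_span S"
  by (induction A rule: infinite_finite_induct) (auto simp: int_span_zero int_span_add)

lemma int_span_base: "finite S \<Longrightarrow> x \<in> S \<Longrightarrow> x \<in> int_span S"
  unfolding int_span_eq
  by (auto intro!: exI[of _ "\<lambda>y. if y = x then 1 else 0"] simp: if_distrib[of "\<lambda>a. a *\<^sub>R _"] cong: if_cong)

lemma full_latticeE:
  assumes "full_lattice N" obtains B where "finite B" "independent B" "span B = UNIV" "N = int_span B"
  using assms independent_imp_finite unfolding full_lattice_def by blast

text \<open>The relation whose classes are counted by \<^const>\<open>lattice_index\<close>.\<close>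

definition coset_rel :: "'a::real_vector set \<Rightarrow> 'a set \<Rightarrow> ('a \<times> 'a) set" where
  "coset_rel N L = {(x, y). x \<in> N \<and> y \<in> N \<and> x - y \<in> L}"

lemma lattice_index_eq: "lattice_index N L = card (N // coset_rel N L)"
  by (simp add: lattice_index_def coset_rel_def)

context
  fixes N :: "'a::euclidean_space set"
  assumes N: "full_lattice N"
begin

lemma lattice_zero: "0 \<in> N"
  and lattice_add: "x \<in> N \<Longrightarrow> y \<in> N \<Longrightarrow> x + y \<in> N"
  and lattice_diff: "x \<in> N \<Longrightarrow> y \<in> N \<Longrightarrow> x - y \<in> N"
  and lattice_scale: "k \<in> \<int> \<Longrightarrow> x \<in> N \<Longrightarrow> k *\<^sub>R x \<in> N"
  using N int_span_zero int_span_add int_span_diff int_span_scale unfolding full_lattice_def by metis+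

lemma lattice_sum: "(\<And>x. x \<in> A \<Longrightarrow> f x \<in> N) \<Longrightarrow> sum f A \<in> N"
  by (induction A rule: infinite_finite_induct) (auto simp: lattice_zero lattice_add)

lemma int_span_subset_lattice: "S \<subseteq> N \<Longrightarrow> int_span S \<subseteq> N"
  unfolding int_span_eq by (auto intro!: lattice_sum lattice_scale)

text \<open>The coordinates with respect to a lattice basis are bounded on a bounded set, and they are
  integers on the lattice.\<close>

lemma finite_lattice_Int_bounded:
  assumes "bounded X" shows "finite (N \<inter> X)"
proof -
  obtain B where B: "finite B" "independent B" "span B = UNIV" "N = int_span B"
    using full_latticeE[OF N] by blast
  have coord: "\<exists>K. \<forall>x\<in>X. \<bar>representation B x b\<bar> \<le> K" for b
  proof -
    have "linear (\<lambda>x. representation B x b)"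
      using B by (intro linearI) (auto simp: representation_add representation_scale)
    then have "bounded ((\<lambda>x. representation B x b) ` X)"
      using assms by (rule bounded_linear_image[rotated, OF linear_conv_bounded_linear[THEN iffD1]])
    then show ?thesis by (auto simp: bounded_iff)
  qed
  then obtain K where K: "\<And>b x. x \<in> X \<Longrightarrow> \<bar>representation B x b\<bar> \<le> K b" by metis
  let ?C = "\<Pi>\<^sub>E b\<in>B. {z::int. \<bar>real_of_int z\<bar> \<le> K b}"
  have "finite {z::int. \<bar>real_of_int z\<bar> \<le> k}" for k :: real
    by (rule finite_subset[of _ "{- \<lceil>k\<rceil>..\<lceil>k\<rceil>}"]) (auto simp: abs_le_iff, linarith+)
  then have fin: "finite ?C" by (intro finite_PiE B(1)) auto
  have "N \<inter> X \<subseteq> (\<lambda>c. \<Sum>b\<in>B. of_int (c b) *\<^sub>R b) ` ?C"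
  proof
    fix x assume x: "x \<in> N \<inter> X"
    then obtain c :: "'a \<Rightarrow> int" where c: "x = (\<Sum>b\<in>B. of_int (c b) *\<^sub>R b)"
      using B(4) by (auto simp: int_span_def)
    have "representation B x b = of_int (c b)" if "b \<in> B" for b
      using that B unfolding c
      by (subst representation_sum) (auto simp: representation_scale representation_basis span_base
          if_distrib[of "\<lambda>a. _ * a"] cong: if_cong intro: span_scale)
    then have "restrict c B \<in> ?C" using K x by (auto, metis)
    moreover have "x = (\<Sum>b\<in>B. of_int (restrict c B b) *\<^sub>R b)" using c by simp
    ultimately show "x \<in> (\<lambda>c. \<Sum>b\<in>B. of_int (c b) *\<^sub>R b) ` ?C" by blast
  qed
  then show ?thesis using fin finite_surj by blast
qed

lemma equiv_coset_rel: "equiv N (coset_rel N (int_span S))"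
proof (intro equivI)
  show "refl_on N (coset_rel N (int_span S))" "coset_rel N (int_span S) \<subseteq> N \<times> N"
    by (auto simp: refl_on_def coset_rel_def int_span_zero)
  show "sym (coset_rel N (int_span S))"
    using int_span_diff[OF int_span_zero, of _ S] by (fastforce simp: sym_def coset_rel_def)
  show "trans (coset_rel N (int_span S))"
  proof (rule transI)
    fix x y z assume "(x, y) \<in> coset_rel N (int_span S)" "(y, z) \<in> coset_rel N (int_span S)"
    then show "(x, z) \<in> coset_rel N (int_span S)"
      using int_span_add[of "x - y" S "y - z"] by (auto simp: coset_rel_def)
  qed
qed

text \<open>Rounding down the coordinates with respect to \<open>S\<close> moves every lattice point into a fixed
  ball without changing its coset.\<close>

lemma finite_index:
  assumes "finite S" "S \<subseteq> N" "span S = UNIV"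
  shows "finite (N // coset_rel N (int_span S))"
proof -
  let ?R = "coset_rel N (int_span S)"
  let ?X = "cball 0 (\<Sum>s\<in>S. norm s)"
  have "\<exists>y\<in>N \<inter> ?X. (y, x) \<in> ?R" if "x \<in> N" for x
  proof -
    obtain u where u: "x = (\<Sum>s\<in>S. u s *\<^sub>R s)"
      using span_finite[OF assms(1)] UNIV_I[of x] unfolding assms(3) by fastforce
    let ?z = "\<Sum>s\<in>S. of_int \<lfloor>u s\<rfloor> *\<^sub>R s"
    have z: "?z \<in> int_span S" by (auto simp: int_span_def)
    then have zN: "?z \<in> N" using int_span_subset_lattice assms by blast
    have "x - ?z = (\<Sum>s\<in>S. frac (u s) *\<^sub>R s)"
      unfolding u by (simp add: frac_def scaleR_diff_left sum_subtractf)
    also have "norm \<dots> \<le> (\<Sum>s\<in>S. norm s)"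
      by (intro sum_norm_le) (auto simp: mult_left_le_one_le frac_lt_1 less_imp_le)
    finally have "x - ?z \<in> N \<inter> ?X" using that zN lattice_diff by auto
    moreover have "x - ?z - x \<in> int_span S" using int_span_diff[OF int_span_zero z] by simp
    ultimately show ?thesis using that by (auto simp: coset_rel_def intro!: bexI[of _ "x - ?z"])
  qed
  have "N // ?R \<subseteq> (\<lambda>y. ?R `` {y}) ` (N \<inter> ?X)"
  proof
    fix C assume "C \<in> N // ?R"
    then obtain x where x: "x \<in> N" "C = ?R `` {x}" by (auto simp: quotient_def)
    then obtain y where "y \<in> N \<inter> ?X" "(y, x) \<in> ?R"
      using \<open>\<And>x. x \<in> N \<Longrightarrow> \<exists>y\<in>N \<inter> ?X. (y, x) \<in> ?R\<close> by blast
    then show "C \<in> (\<lambda>y. ?R `` {y}) ` (N \<inter> ?X)"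
      using equiv_class_eq[OF equiv_coset_rel] x(2) by blast
  qed
  then show ?thesis by (rule finite_surj[OF finite_lattice_Int_bounded[OF bounded_cball]])
qed

text \<open>Two multiples of \<open>x\<close> lie in the same coset, because there are only finitely many cosets.\<close>

lemma lattice_torsion:
  assumes "finite S" "S \<subseteq> N" "span S = UNIV" "x \<in> N"
  shows "\<exists>k::nat. k > 0 \<and> real k *\<^sub>R x \<in> int_span S"
proof -
  let ?R = "coset_rel N (int_span S)" and ?f = "\<lambda>k::nat. coset_rel N (int_span S) `` {real k *\<^sub>R x}"
  have mem: "real k *\<^sub>R x \<in> N" for k using lattice_scale assms by simp
  then have "range ?f \<subseteq> N // ?R" by (auto intro: quotientI)
  then have "finite (range ?f)" using finite_index[OF assms(1-3)] by (rule finite_subset)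
  then have "\<not> inj ?f" using finite_imageD by blast
  then obtain k l where kl: "k < l" "?f l = ?f k" unfolding inj_def by (metis linorder_neqE_nat)
  have "(real l *\<^sub>R x, real k *\<^sub>R x) \<in> ?R"
    using eq_equiv_class[OF kl(2) equiv_coset_rel mem] .
  then have "real (l - k) *\<^sub>R x \<in> int_span S"
    using kl by (simp add: coset_rel_def of_nat_diff algebra_simps)
  then show ?thesis using kl by (intro exI[of _ "l - k"]) auto
qed

lemma lattice_common_torsion:
  assumes "finite S" "S \<subseteq> N" "span S = UNIV"
  shows "\<exists>k::nat. k > 0 \<and> (\<forall>x\<in>N. real k *\<^sub>R x \<in> int_span S)"
proof -
  obtain B where B: "finite B" "N = int_span B" using full_latticeE[OF N] by blast
  have "B \<subseteq> N" using int_span_base B by auto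
  then obtain k where k: "\<And>b. b \<in> B \<Longrightarrow> k b > (0::nat) \<and> real (k b) *\<^sub>R b \<in> int_span S"
    using lattice_torsion[OF assms] by (metis subsetD)
  let ?K = "real (prod k B)"
  have gen: "?K *\<^sub>R b \<in> int_span S" if "b \<in> B" for b
  proof -
    have "?K *\<^sub>R b = real (prod k (B - {b})) *\<^sub>R (real (k b) *\<^sub>R b)"
      using prod.remove[OF B(1) that, of k] by (simp add: mult.commute)
    then show ?thesis using k[OF that] int_span_scale by (metis Ints_of_nat)
  qed
  have "?K *\<^sub>R x \<in> int_span S" if x: "x \<in> N" for x
  proof -
    obtain c :: "'a \<Rightarrow> int" where c: "x = (\<Sum>b\<in>B. of_int (c b) *\<^sub>R b)"
      using x B(2) by (auto simp: int_span_def)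
    have "?K *\<^sub>R x = (\<Sum>b\<in>B. of_int (c b) *\<^sub>R (?K *\<^sub>R b))"
      unfolding c by (simp add: scaleR_sum_right mult.commute del: of_nat_prod)
    also have "\<dots> \<in> int_span S"
      by (rule int_span_sum, rule int_span_scale[OF _ gen]) auto
    finally show ?thesis .
  qed
  moreover have "prod k B > 0" using k by (simp add: prod_pos)
  ultimately show ?thesis by (intro exI[of _ "prod k B"]) blast
qed

end

section \<open>The facets of a Fano simplex\<close>

lemma affine_independent_affinity:
  fixes S :: "'a::euclidean_space set"
  assumes S: "\<not> affine_dependent S" and t: "t \<noteq> 0"
  shows "\<not> affine_dependent ((\<lambda>x. a + t *\<^sub>R x) ` S)"
proof
  let ?f = "\<lambda>x. a + t *\<^sub>R x"
  have fin: "finite S" using S aff_independent_finite by blast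
  have inj: "inj_on ?f S" using t by (auto intro: inj_onI)
  assume "affine_dependent (?f ` S)"
  then obtain U where U: "sum U (?f ` S) = 0" "\<exists>x\<in>?f ` S. U x \<noteq> 0" "(\<Sum>x\<in>?f ` S. U x *\<^sub>R x) = 0"
    using affine_dependent_explicit_finite[of "?f ` S"] fin by auto
  have 1: "(\<Sum>x\<in>S. U (?f x)) = 0" using U(1) by (simp add: sum.reindex[OF inj])
  have "0 = (\<Sum>x\<in>S. U (?f x) *\<^sub>R ?f x)" using U(3) by (simp add: sum.reindex[OF inj])
  also have "\<dots> = (\<Sum>x\<in>S. U (?f x)) *\<^sub>R a + t *\<^sub>R (\<Sum>x\<in>S. U (?f x) *\<^sub>R x)"
    by (simp add: scaleR_add_right sum.distrib scaleR_sum_left scaleR_sum_right mult.commute)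
  finally have "(\<Sum>x\<in>S. U (?f x) *\<^sub>R x) = 0" using 1 t by simp
  then have "affine_dependent S"
    using 1 U(2) unfolding affine_dependent_explicit_finite[OF fin] by (intro exI[of _ "\<lambda>x. U (?f x)"]) auto
  with S show False by simp
qed

text \<open>A Fano simplex is handled through its vertex set \<open>V\<close> and the barycentric coordinates \<open>\<beta>\<close> of the
  origin; facets are indexed by the opposite vertex. Carrying \<open>\<beta>\<close> along turns the condition on
  the interior into linear algebra.\<close>

locale fano_vertices =
  fixes N V :: "'a::euclidean_space set" and \<beta> :: "'a \<Rightarrow> real"
  assumes lattice: "full_lattice N"
    and fin: "finite V" and card_V: "card V = DIM('a) + 1"
    and aff_indep: "\<not> affine_dependent V"
    and pos: "x \<in> V \<Longrightarrow> \<beta> x > 0"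
    and sum_beta: "sum \<beta> V = 1"
    and bary: "(\<Sum>x\<in>V. \<beta> x *\<^sub>R x) = 0"
    and prim: "x \<in> V \<Longrightarrow> primitive_in N x"
begin

lemma V_sub: "V \<subseteq> N"
  using prim by (auto simp: primitive_in_def)

text \<open>Subtracting the right multiple of the barycentric relation from a linear relation gives an
  affine one, which is trivial.\<close>

lemma relation_multiple:
  assumes "(\<Sum>x\<in>V. c x *\<^sub>R x) = 0" "x \<in> V"
  shows "c x = sum c V * \<beta> x"
proof -
  let ?U = "\<lambda>x. c x - sum c V * \<beta> x"
  have "sum ?U V = 0" by (simp add: sum_subtractf sum_distrib_left[symmetric] sum_beta)
  moreover have "(\<Sum>x\<in>V. ?U x *\<^sub>R x) = 0"
    using assms(1) bary
    by (simp add: scaleR_diff_left sum_subtractf scaleR_scaleR[symmetric] scaleR_sum_right[symmetric]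
        del: scaleR_scaleR)
  ultimately have "?U x = 0"
    using aff_indep assms(2) unfolding affine_dependent_explicit_finite[OF fin] by blast
  then show ?thesis by simp
qed

lemma facet_independent:
  assumes "p \<in> V" shows "independent (V - {p})"
proof
  assume "dependent (V - {p})"
  then obtain u where u: "\<exists>x\<in>V - {p}. u x \<noteq> 0" "(\<Sum>x\<in>V - {p}. u x *\<^sub>R x) = 0"
    using fin by (auto simp: dependent_finite)
  let ?c = "\<lambda>x. if x = p then 0 else u x"
  have "(\<Sum>x\<in>V. ?c x *\<^sub>R x) = 0"
    using u(2) fin assms by (simp add: sum.remove[of V p])
  note r = relation_multiple[OF this]
  have "sum ?c V = 0" using r[OF assms] pos[OF assms] by simp
  then have "?c x = 0" if "x \<in> V" for x using r[OF that] by simp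
  then show False using u(1) by (metis DiffE insertI1)
qed

lemma card_facet: "p \<in> V \<Longrightarrow> card (V - {p}) = DIM('a)"
  using fin card_V by simp

lemma facet_ne: "p \<in> V \<Longrightarrow> V - {p} \<noteq> {}"
  using card_facet by (metis card.empty DIM_positive less_irrefl)

lemma span_facet:
  assumes "p \<in> V" shows "span (V - {p}) = UNIV"
  using card_ge_dim_independent[of "V - {p}" UNIV] facet_independent[OF assms] card_facet[OF assms]
  by (auto simp: dim_UNIV[where 'a='a])

text \<open>This is the quotient \<open>h\<^sub>m\<^sub>a\<^sub>x / d\<^sub>F\<close> for the facet \<open>F\<close> opposite \<open>p\<close>, see \<open>h_max_eq\<close> below; in this form it
  is defined without the normal of the facet.\<close>

definition ratio :: "'a \<Rightarrow> real" where
  "ratio p = (1 - \<beta> p) / \<beta> p"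

lemma sum_beta_facet: "p \<in> V \<Longrightarrow> sum \<beta> (V - {p}) = 1 - \<beta> p"
  using sum.remove[OF fin, of p \<beta>] sum_beta by simp

lemma beta_less_1: "p \<in> V \<Longrightarrow> \<beta> p < 1"
  using sum_pos[of "V - {p}" \<beta>] facet_ne fin pos sum_beta_facet by force

lemma ratio_pos: "p \<in> V \<Longrightarrow> ratio p > 0"
  using beta_less_1 pos by (simp add: ratio_def)

lemma ratio_beta: "p \<in> V \<Longrightarrow> ratio p * \<beta> p = 1 - \<beta> p"
  using pos[of p] by (simp add: ratio_def)

lemma inner_opposite:
  assumes "p \<in> V" "\<And>x. x \<in> V - {p} \<Longrightarrow> u \<bullet> x = c"
  shows "u \<bullet> p = - ratio p * c"
proof -
  have "0 = u \<bullet> (\<Sum>x\<in>V. \<beta> x *\<^sub>R x)" by (simp add: bary)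
  also have "\<dots> = \<beta> p * (u \<bullet> p) + (\<Sum>x\<in>V - {p}. \<beta> x * (u \<bullet> x))"
    using assms(1) fin by (simp add: inner_sum_right inner_add_right sum.remove[of V p])
  also have "(\<Sum>x\<in>V - {p}. \<beta> x * (u \<bullet> x)) = (1 - \<beta> p) * c"
    using assms by (simp add: sum_beta_facet flip: sum_distrib_right)
  finally show ?thesis using pos[OF assms(1)] by (simp add: ratio_def field_simps)
qed

lemma facet_functional:
  assumes "p \<in> V" obtains w where "\<And>x. x \<in> V - {p} \<Longrightarrow> w \<bullet> x = 1"
proof -
  obtain f :: "'a \<Rightarrow> real" where f: "linear f" "\<And>x. x \<in> V - {p} \<Longrightarrow> f x = 1"
    using linear_independent_extend[OF facet_independent[OF assms], of "\<lambda>_. 1"] by blast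
  have "adjoint f 1 \<bullet> x = f x" for x
    using adjoint_works[OF f(1), of x 1] by (simp add: inner_commute)
  then show ?thesis using that[of "adjoint f 1"] f(2) by simp
qed

lemma eq_on_facet:
  assumes "p \<in> V" "\<And>x. x \<in> V - {p} \<Longrightarrow> u \<bullet> x = w \<bullet> x"
  shows "u = (w::'a)"
proof -
  have "(u - w) \<bullet> y = 0" for y
  proof -
    have "y \<in> span (V - {p})" using span_facet[OF assms(1)] by simp
    moreover have "subspace {y. (u - w) \<bullet> y = 0}" by (rule subspace_hyperplane)
    moreover have "V - {p} \<subseteq> {y. (u - w) \<bullet> y = 0}" using assms(2) by (auto simp: inner_diff_left)
    ultimately show ?thesis using span_minimal[of "V - {p}" "{y. (u - w) \<bullet> y = 0}"] by blast
  qed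
  from this[of "u - w"] show ?thesis by simp
qed

text \<open>Both vectors are positive integer multiples, by \<open>m\<close> and \<open>n\<close>, of the functional that is 1 on the
  facet. By Bezout its multiple by \<open>gcd m n\<close> is in the dual lattice as well, and a primitive vector
  can only be the trivial multiple of it.\<close>

lemma primitive_normal_unique:
  assumes p: "p \<in> V"
    and u: "primitive_in (dual_lattice N) u" "\<And>x. x \<in> V - {p} \<Longrightarrow> u \<bullet> x = c" "c > 0"
    and w: "primitive_in (dual_lattice N) w" "\<And>x. x \<in> V - {p} \<Longrightarrow> w \<bullet> x = d" "d > 0"
  shows "u = w"
proof -
  obtain q where q: "q \<in> V - {p}" using facet_ne[OF p] by blast
  obtain \<nu> where \<nu>: "\<And>x. x \<in> V - {p} \<Longrightarrow> \<nu> \<bullet> x = 1" using facet_functional[OF p] by blast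
  have uw: "u = c *\<^sub>R \<nu>" "w = d *\<^sub>R \<nu>"
    by (rule eq_on_facet[OF p]; simp add: u w \<nu>)+
  have dual: "u \<in> dual_lattice N" "w \<in> dual_lattice N" using u w by (auto simp: primitive_in_def)
  have "u \<bullet> q \<in> \<int>" "w \<bullet> q \<in> \<int>" using dual q V_sub by (auto simp: dual_lattice_def)
  then obtain m n where mn: "c = of_int m" "d = of_int n" using u(2) w(2) q by (metis Ints_cases)
  have mn0: "m > 0" "n > 0" using mn u(3) w(3) by auto
  obtain a b where ab: "a * m + b * n = gcd m n" using bezout_int[of m n] by blast
  let ?g = "gcd m n"
  let ?y = "of_int ?g *\<^sub>R \<nu>"
  have "?y = of_int a *\<^sub>R u + of_int b *\<^sub>R w"
    unfolding uw mn ab[symmetric] by (simp add: scaleR_add_left)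
  then have y: "?y \<in> dual_lattice N" using dual by (auto simp: dual_lattice_def inner_add_left)
  have "nat (k div ?g) = 1" if "k > 0" "?g dvd k" "primitive_in (dual_lattice N) (of_int k *\<^sub>R \<nu>)" for k
  proof -
    have "k = (k div ?g) * ?g" using that by simp
    then have "real_of_int k = real (nat (k div ?g)) * of_int ?g"
      using that mn0 by (metis int_nat_eq of_int_mult of_int_of_nat_eq order_less_imp_le
          pos_imp_zdiv_nonneg_iff gcd_pos_int less_irrefl)
    then have "of_int k *\<^sub>R \<nu> = real (nat (k div ?g)) *\<^sub>R ?y" by simp
    with that(3) y show ?thesis unfolding primitive_in_def by blast
  qed
  from this[of m] this[of n] have "nat (m div ?g) = 1" "nat (n div ?g) = 1"
    using mn0 u(1) w(1) uw mn by auto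
  then have "m div ?g = 1" "n div ?g = 1" by linarith+
  then have "m = ?g" "n = ?g" by (metis dvd_mult_div_cancel gcd_dvd1 gcd_dvd2 mult.right_neutral)+
  then have "m = n" by linarith
  with uw mn show ?thesis by simp
qed

text \<open>The functional that is 1 on the facet becomes integral after multiplication with the exponent
  of \<open>N\<close> modulo the span of the facet; the least such multiple is primitive.\<close>

lemma primitive_normal_exists:
  assumes p: "p \<in> V"
  shows "\<exists>u. \<exists>d::int. primitive_in (dual_lattice N) u \<and> d > 0 \<and> (\<forall>x\<in>V - {p}. u \<bullet> x = of_int d)"
proof -
  obtain q where q: "q \<in> V - {p}" using facet_ne[OF p] by blast
  obtain \<nu> where \<nu>: "\<And>x. x \<in> V - {p} \<Longrightarrow> \<nu> \<bullet> x = 1" using facet_functional[OF p] by blast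
  let ?P = "\<lambda>k::nat. k > 0 \<and> real k *\<^sub>R \<nu> \<in> dual_lattice N"
  obtain k :: nat where k: "k > 0" "\<And>x. x \<in> N \<Longrightarrow> real k *\<^sub>R x \<in> int_span (V - {p})"
    using lattice_common_torsion[OF lattice, of "V - {p}"] fin V_sub span_facet[OF p]
    by (metis Diff_subset finite_Diff subset_trans)
  have "(real k *\<^sub>R \<nu>) \<bullet> x \<in> \<int>" if x: "x \<in> N" for x
  proof -
    have "(real k *\<^sub>R \<nu>) \<bullet> x = \<nu> \<bullet> (real k *\<^sub>R x)" by simp
    moreover obtain c :: "'a \<Rightarrow> int" where "real k *\<^sub>R x = (\<Sum>y\<in>V - {p}. of_int (c y) *\<^sub>R y)"
      using k(2)[OF x] by (auto simp: int_span_def)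
    ultimately have "(real k *\<^sub>R \<nu>) \<bullet> x = (\<Sum>y\<in>V - {p}. of_int (c y))"
      by (simp add: inner_sum_right \<nu>)
    then show ?thesis by (simp flip: of_int_sum)
  qed
  then have "?P k" using k(1) by (auto simp: dual_lattice_def)
  define d where "d = (LEAST k. ?P k)"
  have d: "?P d" unfolding d_def by (rule LeastI[of ?P, OF \<open>?P k\<close>])
  have least: "d \<le> j" if "?P j" for j unfolding d_def using that by (rule Least_le)
  have "primitive_in (dual_lattice N) (real d *\<^sub>R \<nu>)"
    unfolding primitive_in_def
  proof (intro conjI ballI allI impI)
    show "real d *\<^sub>R \<nu> \<in> dual_lattice N" using d by simp
    show "real d *\<^sub>R \<nu> \<noteq> 0" using d \<nu>[OF q] by auto
    fix y and j :: nat assume y: "y \<in> dual_lattice N" "real d *\<^sub>R \<nu> = real j *\<^sub>R y"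
    have j: "real d = real j * (y \<bullet> q)"
      using arg_cong[OF y(2), of "\<lambda>z. z \<bullet> q"] \<nu>[OF q] by simp
    obtain m where m: "y \<bullet> q = of_int m"
      using y(1) q V_sub by (auto simp: dual_lattice_def elim!: Ints_cases dest!: bspec)
    have "j > 0" using j d by (cases j) auto
    have "m > 0"
      using zero_less_mult_pos[of "real j" "of_int m"] j m d \<open>j > 0\<close> by simp
    have djm: "d = j * nat m"
    proof -
      have "real d = real (j * nat m)" using j m \<open>m > 0\<close> by simp
      then show ?thesis by (simp only: of_nat_eq_iff)
    qed
    have "real j *\<^sub>R y = real j *\<^sub>R (real (nat m) *\<^sub>R \<nu>)" using y(2) djm by simp
    then have "y = real (nat m) *\<^sub>R \<nu>" using \<open>j > 0\<close> by (subst (asm) scaleR_cancel_left) auto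
    then have "?P (nat m)" using y \<open>m > 0\<close> by simp
    then have "d \<le> nat m" by (rule least)
    then have "j * nat m \<le> 1 * nat m" using djm by simp
    then show "j = 1" using \<open>m > 0\<close> \<open>j > 0\<close> mult_le_cancel2[of j "nat m" 1] by simp
  qed
  then show ?thesis using d \<nu> by (intro exI[of _ "real d *\<^sub>R \<nu>"] exI[of _ "int d"]) auto
qed

abbreviation fnormal :: "'a \<Rightarrow> 'a" where
  "fnormal p \<equiv> facet_normal N (convex hull V) (convex hull (V - {p}))"

abbreviation fdist :: "'a \<Rightarrow> int" where
  "fdist p \<equiv> facet_dist N (convex hull V) (convex hull (V - {p}))"

lemma zero_in_hull: "0 \<in> convex hull V"
  using bary sum_beta pos fin by (auto simp: convex_hull_finite less_imp_le intro!: exI[of _ \<beta>])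

lemma facet_normal_eqI:
  assumes p: "p \<in> V" and u: "primitive_in (dual_lattice N) u" "\<And>x. x \<in> V - {p} \<Longrightarrow> u \<bullet> x = c" "c > 0"
  shows "fnormal p = u"
  unfolding facet_normal_def
proof (rule the_equality)
  have "convex hull (V - {p}) \<subseteq> {x. u \<bullet> x = c}"
    using u(2) by (intro hull_minimal) (auto simp: convex_hyperplane)
  moreover have "convex hull V \<subseteq> {x. u \<bullet> x \<le> c}"
  proof (intro hull_minimal subsetI)
    fix x assume "x \<in> V"
    have "- ratio p * c \<le> 0" using ratio_pos[OF p] u(3) by (simp add: mult_le_0_iff)
    then have "u \<bullet> p \<le> c" using inner_opposite[OF p u(2)] u(3) by linarith
    with \<open>x \<in> V\<close> u(2) show "x \<in> {x. u \<bullet> x \<le> c}" by (cases "x = p") auto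
  qed (simp add: convex_halfspace_le)
  ultimately show "primitive_in (dual_lattice N) u \<and>
      (\<exists>c. convex hull (V - {p}) \<subseteq> {x. u \<bullet> x = c} \<and> convex hull V \<subseteq> {x. u \<bullet> x \<le> c})"
    using u(1) by blast
next
  fix w assume w: "primitive_in (dual_lattice N) w \<and>
      (\<exists>c. convex hull (V - {p}) \<subseteq> {x. w \<bullet> x = c} \<and> convex hull V \<subseteq> {x. w \<bullet> x \<le> c})"
  then obtain d where d: "convex hull (V - {p}) \<subseteq> {x. w \<bullet> x = d}" "convex hull V \<subseteq> {x. w \<bullet> x \<le> d}"
    by blast
  have wd: "w \<bullet> x = d" if "x \<in> V - {p}" for x using hull_inc[OF that, of convex] d(1) by blast
  have "d \<ge> 0" using d(2) zero_in_hull by auto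
  moreover have "d \<noteq> 0"
    using eq_on_facet[OF p, of w 0] wd w by (auto simp: primitive_in_def)
  ultimately show "w = u" using primitive_normal_unique[OF p _ wd _ u] w by simp
qed

lemma facet_dist_eqI:
  assumes p: "p \<in> V" and "\<And>x. x \<in> V - {p} \<Longrightarrow> fnormal p \<bullet> x = of_int c"
  shows "fdist p = c"
  unfolding facet_dist_def
proof (rule the_equality)
  show *: "\<forall>x\<in>convex hull (V - {p}). fnormal p \<bullet> x = of_int c"
    using hull_minimal[of "V - {p}" "{x. fnormal p \<bullet> x = of_int c}" convex] assms(2)
    by (auto simp: convex_hyperplane)
  obtain q where "q \<in> convex hull (V - {p})" using facet_ne[OF p] hull_inc[of _ "V - {p}" convex] by blast
  then show "\<And>d. \<forall>x\<in>convex hull (V - {p}). fnormal p \<bullet> x = of_int d \<Longrightarrow> d = c"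
    using * by force
qed

lemma fnormal:
  assumes p: "p \<in> V"
  shows primitive_fnormal: "primitive_in (dual_lattice N) (fnormal p)"
    and fdist_pos: "fdist p > 0"
    and fnormal_facet: "x \<in> V - {p} \<Longrightarrow> fnormal p \<bullet> x = of_int (fdist p)"
    and fnormal_opposite: "fnormal p \<bullet> p = - ratio p * of_int (fdist p)"
proof -
  obtain u and d :: int where u: "primitive_in (dual_lattice N) u" "d > 0"
      "\<And>x. x \<in> V - {p} \<Longrightarrow> u \<bullet> x = of_int d"
    using primitive_normal_exists[OF p] by blast
  have eq: "fnormal p = u" using u by (intro facet_normal_eqI[OF p, of u "of_int d"]) auto
  have d: "fdist p = d" using u(3) by (intro facet_dist_eqI[OF p]) (simp add: eq)
  show "primitive_in (dual_lattice N) (fnormal p)" "fdist p > 0"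
    "x \<in> V - {p} \<Longrightarrow> fnormal p \<bullet> x = of_int (fdist p)"
    using u d eq by auto
  show "fnormal p \<bullet> p = - ratio p * of_int (fdist p)"
    using u d eq by (intro inner_opposite[OF p]) auto
qed

lemma fnormal_int: "p \<in> V \<Longrightarrow> x \<in> N \<Longrightarrow> fnormal p \<bullet> x \<in> \<int>"
  using primitive_fnormal by (auto simp: primitive_in_def dual_lattice_def)

lemma extreme_point_hull: "x extreme_point_of convex hull V \<longleftrightarrow> x \<in> V"
  by (rule extreme_point_of_convex_hull_affine_independent[OF aff_indep])

lemma extreme_point_facet: "x extreme_point_of convex hull (V - {p}) \<longleftrightarrow> x \<in> V - {p}"
  by (intro extreme_point_of_convex_hull_affine_independent affine_independent_Diff aff_indep)

lemma facet_iff: "F facet_of convex hull V \<longleftrightarrow> (\<exists>p\<in>V. F = convex hull (V - {p}))"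
  unfolding facet_of_convex_hull_affine_independent[OF aff_indep] using facet_ne by force

lemma facet_inj: "inj_on (\<lambda>p. convex hull (V - {p})) V"
proof (rule inj_onI)
  fix p q assume "p \<in> V" "q \<in> V" "convex hull (V - {p}) = convex hull (V - {q})"
  then have "V - {p} = V - {q}" using extreme_point_facet by (metis subsetI subset_antisym)
  with \<open>p \<in> V\<close> \<open>q \<in> V\<close> show "p = q" by blast
qed

text \<open>Admissibility of the facet opposite \<open>p\<close> as a condition on its edges, see
  \<open>admissible_facet_iff\<close>.\<close>

definition adm :: "'a \<Rightarrow> bool" where
  "adm p \<longleftrightarrow> (\<forall>x\<in>V - {p}. \<forall>y\<in>V - {p}. (1 / of_int (fdist p)) *\<^sub>R (x - y) \<in> N)"

lemma admI:
  assumes "r \<in> V - {p}" "\<And>x. x \<in> V - {p} \<Longrightarrow> (1 / of_int (fdist p)) *\<^sub>R (x - r) \<in> N"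
  shows "adm p"
  unfolding adm_def
proof (intro ballI)
  fix x y assume "x \<in> V - {p}" "y \<in> V - {p}"
  from lattice_diff[OF lattice assms(2)[OF this(1)] assms(2)[OF this(2)]]
  show "(1 / of_int (fdist p)) *\<^sub>R (x - y) \<in> N" by (simp add: scaleR_diff_right[symmetric] del: scaleR_diff_right) 
qed

text \<open>The vertices of \<open>F\<close> are extreme, so they come from lattice points generating the polytope \<open>G\<close>;
  conversely the scaled differences of vertices generate such a \<open>G\<close>.\<close>

lemma admissible_facet_iff:
  assumes p: "p \<in> V"
  shows "admissible N (convex hull V) (convex hull (V - {p})) \<longleftrightarrow> adm p"
proof
  let ?F = "convex hull (V - {p})"
  define d where d_def: "d = real_of_int (fdist p)"
  have d: "d > 0" using fdist_pos[OF p] by (simp add: d_def)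
  {
    assume "admissible N (convex hull V) ?F"
    then obtain v G where v: "v \<in> V - {p}" and G: "lattice_polytope N G"
        "?F = (\<lambda>x. v + d *\<^sub>R x) ` G"
      unfolding admissible_def extreme_point_facet d_def by blast
    obtain S where S: "S \<subseteq> N" "G = convex hull S" using G(1) by (auto simp: lattice_polytope_def)
    have "(\<lambda>x. v + d *\<^sub>R x) ` (convex hull S) = convex hull ((\<lambda>x. v + d *\<^sub>R x) ` S)"
      by (rule convex_hull_affinity[symmetric])
    then have F: "?F = convex hull ((\<lambda>x. v + d *\<^sub>R x) ` S)" using G S by simp
    show "adm p"
    proof (rule admI[OF v], fold d_def)
      fix x assume "x \<in> V - {p}"
      then have "x extreme_point_of ?F" by (simp add: extreme_point_facet)
      then have "x \<in> (\<lambda>x. v + d *\<^sub>R x) ` S" unfolding F by (rule extreme_point_of_convex_hull)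
      then show "(1 / d) *\<^sub>R (x - v) \<in> N" using S d by auto
    qed
  }
  {
    assume a: "adm p"
    obtain v where v: "v \<in> V - {p}" using facet_ne[OF p] by blast
    let ?f = "\<lambda>x. (1 / d) *\<^sub>R (x - v)" and ?g = "\<lambda>x. v + d *\<^sub>R x"
    let ?G = "?f ` ?F"
    have f: "?f = (\<lambda>x. - (1 / d) *\<^sub>R v + (1 / d) *\<^sub>R x)" by (auto simp: algebra_simps)
    have G: "?G = convex hull (?f ` (V - {p}))"
      unfolding f by (rule convex_hull_affinity[symmetric])
    have gf: "?g (?f x) = x" "?f (?g x) = x" for x using d by (auto simp: algebra_simps)
    have "lattice_polytope N ?G"
      unfolding lattice_polytope_def G using fin a v
      by (intro exI[of _ "?f ` (V - {p})"]) (auto simp: adm_def d_def)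
    moreover have "0 extreme_point_of ?G"
    proof -
      have "\<not> affine_dependent (?f ` (V - {p}))"
        unfolding f using d by (intro affine_independent_affinity affine_independent_Diff aff_indep) simp
      from extreme_point_of_convex_hull_affine_independent[OF this, of 0]
      show ?thesis unfolding G using v by (auto intro!: image_eqI[of _ _ v])
    qed
    moreover have "?F = ?g ` ?G" by (simp only: image_image gf image_ident)
    ultimately show "admissible N (convex hull V) ?F"
      unfolding admissible_def facet_iff d_def using p v extreme_point_facet by blast
  }
qed

lemma admissible_iff:
  "admissible N (convex hull V) F \<longleftrightarrow> (\<exists>p\<in>V. adm p \<and> F = convex hull (V - {p}))"
proof
  assume a: "admissible N (convex hull V) F"
  then obtain p where p: "p \<in> V" "F = convex hull (V - {p})"
    using facet_iff[of F] by (auto simp: admissible_def)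
  with a admissible_facet_iff[OF p(1)] show "\<exists>p\<in>V. adm p \<and> F = convex hull (V - {p})" by blast
qed (use admissible_facet_iff in blast)

lemma ad_eq: "ad N (convex hull V) = card {p \<in> V. adm p}"
proof -
  have "{F. admissible N (convex hull V) F} = (\<lambda>p. convex hull (V - {p})) ` {p \<in> V. adm p}"
    by (auto simp: admissible_iff)
  then show ?thesis unfolding ad_def
    using card_image[OF inj_on_subset[OF facet_inj]] by (metis (no_types, lifting) mem_Collect_eq subsetI)
qed

lemma fano_simplex: "fano_simplex N (convex hull V)"
proof -
  have "0 \<in> interior (convex hull V)"
    unfolding interior_convex_hull_explicit_minimal[OF aff_indep]
    using card_V pos sum_beta bary by auto
  then show ?thesis
    unfolding fano_simplex_def fano_polytope_def lattice_polytope_def simplex_def extreme_point_hull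
    using fin V_sub prim aff_indep card_V by auto
qed

end

lemma fano_simplexE:
  assumes "full_lattice N" "fano_simplex N (P :: 'a::euclidean_space set)"
  obtains V \<beta> where "fano_vertices N V \<beta>" "P = convex hull V"
proof -
  obtain V where V: "\<not> affine_dependent V" "card V = DIM('a) + 1" "P = convex hull V"
    using assms unfolding fano_simplex_def simplex_def by force
  have f: "0 \<in> interior (convex hull V)" "\<And>v. v extreme_point_of convex hull V \<Longrightarrow> primitive_in N v"
    using assms unfolding fano_simplex_def fano_polytope_def V(3) by auto
  obtain \<beta> where "\<forall>x\<in>V. 0 < \<beta> x" "sum \<beta> V = 1" "(\<Sum>x\<in>V. \<beta> x *\<^sub>R x) = 0"
    using f(1) V(2) unfolding interior_convex_hull_explicit_minimal[OF V(1)] by auto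
  then have "fano_vertices N V \<beta>"
    using V f(2) assms aff_independent_finite
    by (intro fano_vertices.intro) (auto simp: extreme_point_of_convex_hull_affine_independent)
  then show ?thesis using that V(3) by blast
qed

section \<open>Mutations of Fano simplices\<close>

context fano_vertices
begin

text \<open>The map sends each vertex of the simplex to the vertex of the mutation that has the
  same label. In particular it exchanges \<open>p\<close> and \<open>r\<close>.\<close>

definition mut :: "'a \<Rightarrow> 'a \<Rightarrow> 'a \<Rightarrow> 'a" where
  "mut p r x = (if x = p then r else p + ratio p *\<^sub>R (x - r))"

text \<open>The barycentric coordinates of the origin in the mutated simplex. They are found by comparing
  coefficients: the new relation has to be the old one written in the new vertices.\<close>

definition mut_beta :: "'a \<Rightarrow> 'a \<Rightarrow> 'a \<Rightarrow> real" where
  "mut_beta p r y = (let x = the_inv_into V (mut p r) y in if x = p then 1 - \<beta> p else \<beta> x / ratio p)"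

lemma mut_apex [simp]: "mut p r p = r"
  and mut_base: "x \<noteq> p \<Longrightarrow> mut p r x = p + ratio p *\<^sub>R (x - r)"
  and mut_root [simp]: "r \<noteq> p \<Longrightarrow> mut p r r = p"
  by (simp_all add: mut_def)

lemma fnormal_mut:
  assumes "p \<in> V" "r \<in> V - {p}" "x \<in> V - {p}"
  shows "fnormal p \<bullet> mut p r x = - ratio p * of_int (fdist p)"
  using assms fnormal_facet[of p] fnormal_opposite[of p]
  by (simp add: mut_base inner_add_right inner_diff_right)

lemma mut_inj:
  assumes "p \<in> V" "r \<in> V - {p}"
  shows "inj_on (mut p r) V"
proof -
  have t: "ratio p > 0" "real_of_int (fdist p) > 0" using ratio_pos fdist_pos assms by auto
  have ne: "mut p r x \<noteq> r" if "x \<in> V - {p}" for x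
  proof
    assume "mut p r x = r"
    then have "real_of_int (fdist p) = - ratio p * of_int (fdist p)"
      using fnormal_mut[OF assms that] fnormal_facet[OF assms] by simp
    moreover have "ratio p * of_int (fdist p) > 0" using t by simp
    ultimately show False using t by linarith
  qed
  show ?thesis
  proof (rule inj_onI)
    fix x y assume xy: "x \<in> V" "y \<in> V" "mut p r x = mut p r y"
    show "x = y"
    proof (cases "x = p \<or> y = p")
      case True then show ?thesis using xy ne by (metis DiffI mut_apex singletonD)
    next
      case False then show ?thesis using xy t by (simp add: mut_base)
    qed
  qed
qed

lemma mut_beta_mut:
  assumes "p \<in> V" "r \<in> V - {p}" "x \<in> V"
  shows "mut_beta p r (mut p r x) = (if x = p then 1 - \<beta> p else \<beta> x / ratio p)"
  using the_inv_into_f_f[OF mut_inj[OF assms(1,2)] assms(3)] by (simp add: mut_beta_def)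

lemma mut_image:
  assumes "p \<in> V"
  shows "mut p r ` V = insert r ((\<lambda>x. (p - ratio p *\<^sub>R r) + ratio p *\<^sub>R x) ` (V - {p}))"
proof -
  have "mut p r ` V = insert (mut p r p) (mut p r ` (V - {p}))" using assms by blast
  also have "mut p r ` (V - {p}) = (\<lambda>x. (p - ratio p *\<^sub>R r) + ratio p *\<^sub>R x) ` (V - {p})"
    by (intro image_cong refl) (simp add: mut_base algebra_simps)
  finally show ?thesis by simp
qed

lemma mut_image_diff:
  assumes "p \<in> V" "r \<in> V - {p}" "x \<in> V"
  shows "mut p r ` V - {mut p r x} = mut p r ` (V - {x})"
  using inj_on_image_set_diff[OF mut_inj[OF assms(1,2)], of V "{x}"] assms(3) by auto

lemma mut_edge_lattice:
  assumes "p \<in> V" "r \<in> V - {p}" "adm p" "x \<in> V - {p}"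
  obtains g where "g \<in> N" "x - r = of_int (fdist p) *\<^sub>R g" "fnormal p \<bullet> g = 0"
proof (rule that)
  let ?g = "(1 / of_int (fdist p)) *\<^sub>R (x - r)"
  show "?g \<in> N" using assms by (auto simp: adm_def)
  show "x - r = of_int (fdist p) *\<^sub>R ?g" using fdist_pos[OF assms(1)] by simp
  show "fnormal p \<bullet> ?g = 0" using assms fnormal_facet[of p] by (simp add: inner_diff_right)
qed

text \<open>A new vertex is \<open>p + h g\<close> with \<open>g\<close> a lattice vector of height 0, where \<open>h\<close> is minus the height of
  \<open>p\<close>. A factor of it divides \<open>h\<close> and therefore also \<open>p\<close>.\<close>

lemma mut_primitive:
  assumes "p \<in> V" "r \<in> V - {p}" "adm p" "x \<in> V"
  shows "primitive_in N (mut p r x)"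
proof (cases "x = p")
  case False
  let ?h = "ratio p * of_int (fdist p)"
  obtain g where g: "g \<in> N" "x - r = of_int (fdist p) *\<^sub>R g" "fnormal p \<bullet> g = 0"
    using mut_edge_lattice[OF assms(1-3)] assms(4) False by blast
  have y: "mut p r x = p + ?h *\<^sub>R g" using False g by (simp add: mut_base)
  have np: "fnormal p \<bullet> p = - ?h" using fnormal_opposite assms by simp
  have h: "?h \<in> \<int>" using np fnormal_int[OF assms(1), of p] assms V_sub by auto
  have h0: "?h > 0" using ratio_pos fdist_pos assms by simp
  have p: "primitive_in N p" using prim assms by simp
  show ?thesis unfolding primitive_in_def
  proof (intro conjI ballI allI impI)
    show "mut p r x \<in> N"
      unfolding y using p g h by (intro lattice_add[OF lattice] lattice_scale[OF lattice]) (auto simp: primitive_in_def)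
    show "mut p r x \<noteq> 0"
      using fnormal_mut[OF assms(1,2), of x] False assms(4) h0 by auto
    fix z and k :: nat assume z: "z \<in> N" "mut p r x = real k *\<^sub>R z"
    \<comment> \<open>Pairing with the normal shows that the height is \<open>k\<close> times an integer,
      so the whole multiple can be moved over to the old vertex.\<close>
    have "real k * (fnormal p \<bullet> z) = - ?h"
      using fnormal_mut[OF assms(1,2), of x] False assms(4) z(2) by simp
    then have h_eq: "?h = - real k * (fnormal p \<bullet> z)" by simp
    have "p = mut p r x - ?h *\<^sub>R g" using y by simp
    also have "\<dots> = real k *\<^sub>R (z + (fnormal p \<bullet> z) *\<^sub>R g)"
      unfolding z(2) h_eq by (simp add: scaleR_add_right)
    finally have "p = real k *\<^sub>R (z + (fnormal p \<bullet> z) *\<^sub>R g)" .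
    moreover have "z + (fnormal p \<bullet> z) *\<^sub>R g \<in> N"
      using z g fnormal_int assms by (intro lattice_add[OF lattice] lattice_scale[OF lattice]) auto
    ultimately show "k = 1" using p unfolding primitive_in_def by blast
  qed
qed (use assms prim in auto)

text \<open>The vertices other than \<open>r\<close> are a scaled copy of the facet and lie in a hyperplane that is
  parallel to it and does not contain \<open>r\<close>.\<close>

lemma mut_affine_independent:
  assumes "p \<in> V" "r \<in> V - {p}"
  shows "\<not> affine_dependent (mut p r ` V)"
  unfolding mut_image[OF assms(1)]
proof (rule affine_independent_insert)
  let ?f = "\<lambda>x. (p - ratio p *\<^sub>R r) + ratio p *\<^sub>R x"
  let ?H = "{y. fnormal p \<bullet> y = - ratio p * of_int (fdist p)}"
  have t: "ratio p > 0" "real_of_int (fdist p) > 0" using ratio_pos fdist_pos assms by auto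
  show "\<not> affine_dependent (?f ` (V - {p}))"
    using t by (intro affine_independent_affinity affine_independent_Diff aff_indep) simp
  have "?f x \<in> ?H" if "x \<in> V - {p}" for x
    using fnormal_mut[OF assms that] that by (simp add: mut_base algebra_simps)
  then have "affine hull (?f ` (V - {p})) \<subseteq> ?H"
    by (intro hull_minimal) (auto simp: affine_hyperplane)
  moreover have "r \<notin> ?H"
  proof -
    have "ratio p * of_int (fdist p) > 0" using t by simp
    then have "fnormal p \<bullet> r \<noteq> - ratio p * of_int (fdist p)"
      using fnormal_facet[OF assms] t by linarith
    then show ?thesis by simp
  qed
  ultimately show "r \<notin> affine hull (?f ` (V - {p}))" by blast
qed

lemma sum_mut:
  assumes "p \<in> V" "r \<in> V - {p}"
  shows "(\<Sum>y\<in>mut p r ` V. f y) = f r + (\<Sum>x\<in>V - {p}. f (mut p r x))"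
  using sum.reindex[OF mut_inj[OF assms], of f] sum.remove[OF fin assms(1), of "f \<circ> mut p r"] by simp

lemma mut_fano:
  assumes "p \<in> V" "r \<in> V - {p}" "adm p"
  shows "fano_vertices N (mut p r ` V) (mut_beta p r)"
proof
  let ?t = "ratio p"
  have t: "?t > 0" using ratio_pos assms by simp
  note bm = mut_beta_mut[OF assms(1,2)]
  have br: "mut_beta p r r = 1 - \<beta> p" using bm[OF assms(1)] by simp
  have tb: "(1 - \<beta> p) / ?t = \<beta> p" using ratio_beta[OF assms(1)] t by (simp add: field_simps)
  show "full_lattice N" "finite (mut p r ` V)" using lattice fin by auto
  show "card (mut p r ` V) = DIM('a) + 1" using card_image[OF mut_inj] assms card_V by simp
  show "\<not> affine_dependent (mut p r ` V)" using mut_affine_independent assms by simp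
  show "primitive_in N x" if "x \<in> mut p r ` V" for x using that mut_primitive assms by auto
  show "mut_beta p r x > 0" if "x \<in> mut p r ` V" for x
    using that bm pos beta_less_1[OF assms(1)] t by auto
  have s: "(\<Sum>x\<in>V - {p}. mut_beta p r (mut p r x)) = \<beta> p"
  proof -
    have "(\<Sum>x\<in>V - {p}. mut_beta p r (mut p r x)) = (\<Sum>x\<in>V - {p}. \<beta> x / ?t)"
      by (intro sum.cong refl) (auto simp: bm)
    then show ?thesis using tb by (simp flip: sum_divide_distrib add: sum_beta_facet assms)
  qed
  show "sum (mut_beta p r) (mut p r ` V) = 1" unfolding sum_mut[OF assms(1,2)] br s by simp
  have "(\<Sum>x\<in>V - {p}. mut_beta p r (mut p r x) *\<^sub>R mut p r x)
      = (\<Sum>x\<in>V - {p}. (\<beta> x / ?t) *\<^sub>R p + \<beta> x *\<^sub>R x - \<beta> x *\<^sub>R r)"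
  proof (intro sum.cong refl)
    fix x assume x: "x \<in> V - {p}"
    then have 1: "mut_beta p r (mut p r x) = \<beta> x / ?t" using bm by auto
    have 2: "mut p r x = p + ?t *\<^sub>R (x - r)" using x by (simp add: mut_base)
    show "mut_beta p r (mut p r x) *\<^sub>R mut p r x = (\<beta> x / ?t) *\<^sub>R p + \<beta> x *\<^sub>R x - \<beta> x *\<^sub>R r"
      unfolding 1 unfolding 2 using t by (simp add: scaleR_add_right scaleR_diff_right)
  qed
  also have "\<dots> = ((1 - \<beta> p) / ?t) *\<^sub>R p + (\<Sum>x\<in>V - {p}. \<beta> x *\<^sub>R x) - (1 - \<beta> p) *\<^sub>R r"
    by (simp add: sum.distrib sum_subtractf scaleR_sum_left[symmetric] sum_divide_distrib[symmetric]
        sum_beta_facet assms)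
  also have "\<dots> = (\<Sum>x\<in>V. \<beta> x *\<^sub>R x) - (1 - \<beta> p) *\<^sub>R r"
    unfolding tb using sum.remove[OF fin assms(1), of "\<lambda>x. \<beta> x *\<^sub>R x"] by simp
  finally show "(\<Sum>x\<in>mut p r ` V. mut_beta p r x *\<^sub>R x) = 0"
    unfolding sum_mut[OF assms(1,2)] br by (simp add: bary)
qed

lemma mut_ratio:
  assumes "p \<in> V" "r \<in> V - {p}" "adm p"
  shows "fano_vertices.ratio (mut_beta p r) r = 1 / ratio p"
proof -
  interpret M: fano_vertices N "mut p r ` V" "mut_beta p r" by (rule mut_fano[OF assms])
  have "mut_beta p r r = 1 - \<beta> p" using mut_beta_mut[OF assms(1,2,1)] by simp
  then show ?thesis by (simp add: M.ratio_def ratio_def)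
qed

text \<open>The reverse mutation is over the facet opposite the new vertex \<open>r\<close>, and it uses \<open>p\<close>, the new
  vertex with the label of \<open>r\<close>; the ratio becomes its inverse.\<close>

lemma mut_mut:
  assumes "p \<in> V" "r \<in> V - {p}" "adm p" "x \<in> V"
  shows "fano_vertices.mut (mut_beta p r) r p (mut p r x) = x"
proof -
  interpret M: fano_vertices N "mut p r ` V" "mut_beta p r" by (rule mut_fano[OF assms(1-3)])
  show ?thesis
  proof (cases "x = p")
    case False
    then have "mut p r x \<noteq> r"
      using inj_onD[OF mut_inj[OF assms(1,2)], of x p] assms by auto
    then show ?thesis
      using False ratio_pos[OF assms(1)]
      by (simp add: M.mut_base mut_ratio[OF assms(1-3)] mut_base)
  qed simp
qed

lemma height_eq_int:
  assumes "p \<in> V" shows "ratio p * of_int (fdist p) = of_int \<lfloor>ratio p * of_int (fdist p)\<rfloor>"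
proof -
  have "fnormal p \<bullet> p \<in> \<int>" using fnormal_int assms V_sub by auto
  then have "- ratio p * of_int (fdist p) \<in> \<int>" unfolding fnormal_opposite[OF assms] .
  then have "ratio p * of_int (fdist p) \<in> \<int>" using Ints_minus by fastforce
  then show ?thesis by (metis Ints_cases floor_of_int)
qed

lemma h_max_eq:
  assumes p: "p \<in> V"
  shows "h_max N (convex hull V) (convex hull (V - {p})) = ratio p * of_int (fdist p)"
proof -
  let ?w = "- fnormal p" and ?h = "ratio p * of_int (fdist p)"
  have h0: "?h > 0" using ratio_pos fdist_pos p by simp
  have "convex hull V \<subseteq> {x. ?w \<bullet> x \<le> ?h}"
  proof (intro hull_minimal subsetI)
    fix x assume "x \<in> V"
    then show "x \<in> {x. ?w \<bullet> x \<le> ?h}"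
      using fnormal_facet[OF p, of x] fnormal_opposite[OF p] fdist_pos[OF p] h0 by (cases "x = p") auto
  qed (rule convex_halfspace_le)
  moreover have "?w \<bullet> p = ?h" "p \<in> convex hull V" using fnormal_opposite p hull_inc by auto
  ultimately show ?thesis
    unfolding h_max_def by (intro cSup_eq_maximum) (force, auto)
qed

text \<open>The top slice is \<open>p + h G\<close>, which gives one inclusion. For the other one, all points of \<open>P\<close> at
  a given height are allowed instead of the hull of the lattice points among them: even the real
  slices stay inside the new simplex.\<close>

lemma facet_mutation_eq:
  assumes p: "p \<in> V" and r: "r \<in> V - {p}"
  shows "facet_mutation N (convex hull V) (convex hull (V - {p})) r = convex hull (mut p r ` V)"
proof -
  define F where "F = convex hull (V - {p})"
  define n where "n = facet_normal N (convex hull V) F"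
  define d where "d = real_of_int (facet_dist N (convex hull V) F)"
  define t where "t = ratio p"
  define G where "G = (\<lambda>x. (1 / d) *\<^sub>R (x - r)) ` F"
  define S where "S h = convex hull {x \<in> convex hull V \<inter> N. - n \<bullet> x = of_int h}" for h :: int
  define C where "C = convex hull (mut p r ` V)"
  define A where "A = (\<Union>h\<in>{h. 0 \<le> h \<and> of_int h \<le> t * d}. {s + of_int h *\<^sub>R g |s g. s \<in> S h \<and> g \<in> G})"
  have td: "t > 0" "d > 0" using ratio_pos fdist_pos p by (auto simp: t_def d_def F_def)
  have nr: "n \<bullet> x = d" if "x \<in> V - {p}" for x
    using fnormal_facet[OF p that] by (simp add: n_def d_def F_def)
  have nF: "n \<bullet> x = d" if "x \<in> F" for x
  proof -
    have "F \<subseteq> {x. n \<bullet> x = d}" unfolding F_def using nr by (intro hull_minimal) (auto simp: convex_hyperplane)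
    with that show ?thesis by blast
  qed
  have np: "n \<bullet> p = - t * d" using fnormal_opposite[OF p] by (simp add: n_def d_def F_def t_def)
  have rF: "r \<in> F" unfolding F_def using r by (rule hull_inc)
  have mutF: "p + t *\<^sub>R (x - r) \<in> C" if "x \<in> F" for x
  proof -
    have "(\<lambda>x. (p - t *\<^sub>R r) + t *\<^sub>R x) ` F = convex hull ((\<lambda>x. (p - t *\<^sub>R r) + t *\<^sub>R x) ` (V - {p}))"
      unfolding F_def by (rule convex_hull_affinity[symmetric])
    also have "\<dots> \<subseteq> C"
      unfolding C_def mut_image[OF p] t_def by (intro hull_mono) auto
    finally show ?thesis using that by (auto simp: algebra_simps)
  qed
  have rC: "r \<in> C" unfolding C_def mut_image[OF p] by (intro hull_inc) simp
  have "convex hull ({r} \<union> A) = C"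
  proof (rule antisym)
    show "convex hull ({r} \<union> A) \<subseteq> C"
    proof (rule hull_minimal)
      show "convex C" by (simp add: C_def)
      have "s + of_int h *\<^sub>R g \<in> C" if h: "0 \<le> h" and s: "s \<in> S h" and g: "g \<in> G" for h s g
      proof -
        \<comment> \<open>The slice of the simplex at height \<open>h\<close> is a translate of \<open>b F\<close>, so adding \<open>h G\<close> gives
          a translate of \<open>(b + h / d) F\<close>, which is the slice of the new simplex.\<close>
        let ?X = "convex hull V \<inter> {x. - n \<bullet> x = of_int h}"
        have "S h \<subseteq> ?X"
          unfolding S_def by (intro hull_minimal convex_Int convex_convex_hull convex_hyperplane) auto
        then have s1: "s \<in> convex hull V" "- n \<bullet> s = of_int h" using s by auto
        have "convex hull V = convex hull (insert p (V - {p}))" using p by (simp add: insert_absorb)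
        then obtain a b f where f: "a \<ge> 0" "b \<ge> 0" "a + b = 1" "f \<in> F" "s = a *\<^sub>R p + b *\<^sub>R f"
          using s1(1) convex_hull_insert[OF facet_ne[OF p], of p] unfolding F_def by auto
        obtain f' where f': "f' \<in> F" "g = (1 / d) *\<^sub>R (f' - r)" using g by (auto simp: G_def)
        have "a * (t * d) - b * d = of_int h"
          using s1(2) unfolding f(5) by (simp add: inner_add_right np nF f(4))
        then have hd: "of_int h / d = a * t - b" using td by (simp add: field_simps)
        have at: "a > 0"
        proof (rule ccontr)
          assume "\<not> a > 0"
          then have "a = 0" "b = 1" using f by auto
          then have "of_int h / d < 0" using hd by simp
          moreover have "of_int h / d \<ge> 0" using h td by simp
          ultimately show False by simp
        qed
        define c where "c = of_int h / d"
        have c: "c \<ge> 0" "c = a * t - b" unfolding c_def hd[symmetric] using h td by simp_all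
        \<comment> \<open>The point of \<open>F\<close> whose image, weighted with \<open>a\<close>, combines with \<open>b r\<close> to the given sum.\<close>
        define f'' where "f'' = (b / (a * t)) *\<^sub>R f + (c / (a * t)) *\<^sub>R f'"
        have "b / (a * t) + c / (a * t) = 1" using c at td by (simp add: field_simps)
        then have "f'' \<in> F"
          unfolding f''_def F_def using f f' c at td
          by (intro convexD[OF convex_convex_hull]) (auto simp: F_def)
        have "s + of_int h *\<^sub>R g = a *\<^sub>R p + b *\<^sub>R f + c *\<^sub>R (f' - r)"
          unfolding f(5) f'(2) c_def by simp
        also have "b *\<^sub>R f + c *\<^sub>R f' = (a * t) *\<^sub>R f''"
          unfolding f''_def using at td by (simp add: scaleR_add_right)
        then have "a *\<^sub>R p + b *\<^sub>R f + c *\<^sub>R (f' - r) = a *\<^sub>R p + (a * t) *\<^sub>R f'' - c *\<^sub>R r"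
          by (simp add: scaleR_diff_right algebra_simps)
        also have "\<dots> = a *\<^sub>R (p + t *\<^sub>R (f'' - r)) + b *\<^sub>R r"
          unfolding c(2) by (simp add: algebra_simps)
        also have "\<dots> \<in> C"
          using mutF[OF \<open>f'' \<in> F\<close>] rC f by (intro convexD[of C]) (auto simp: C_def)
        finally show ?thesis .
      qed
      then show "{r} \<union> A \<subseteq> C" using rC by (auto simp: A_def)
    qed
    show "C \<subseteq> convex hull ({r} \<union> A)"
      unfolding C_def
    proof (intro hull_mono subsetI)
      fix y assume "y \<in> mut p r ` V"
      then obtain x where x: "x \<in> V" "y = mut p r x" by blast
      show "y \<in> {r} \<union> A"
      proof (cases "x = p")
        case False
        define h where "h = \<lfloor>t * d\<rfloor>"
        have h: "of_int h = t * d" using height_eq_int[OF p] by (simp add: h_def t_def d_def F_def)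
        have h0: "h \<ge> 0" using td by (simp add: h_def)
        have "p \<in> S h"
          unfolding S_def using hull_inc[OF p, of convex] p V_sub np h by (intro hull_inc) auto
        moreover have "(1 / d) *\<^sub>R (x - r) \<in> G"
          unfolding G_def F_def using hull_inc[of x "V - {p}" convex] x False by auto
        moreover have "y = p + of_int h *\<^sub>R ((1 / d) *\<^sub>R (x - r))"
          unfolding h x(2) using False td by (simp add: mut_base t_def)
        ultimately show ?thesis unfolding A_def using h h0 by force
      qed (simp add: x)
    qed
  qed
  then show ?thesis
    unfolding A_def S_def G_def C_def n_def d_def t_def facet_mutation_def Let_def F_def
    unfolding h_max_eq[OF p] .
qed

end

lemma primitive_dual_uminus:
  assumes "primitive_in (dual_lattice N) u"
  shows "primitive_in (dual_lattice N) (- u)"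
  unfolding primitive_in_def
proof (intro conjI ballI allI impI)
  show "- u \<in> dual_lattice N" "- u \<noteq> 0" using assms by (auto simp: primitive_in_def dual_lattice_def)
  fix y and k :: nat assume y: "y \<in> dual_lattice N" "- u = real k *\<^sub>R y"
  have "- y \<in> dual_lattice N" using y(1) by (simp add: dual_lattice_def)
  moreover have "u = real k *\<^sub>R (- y)" using arg_cong[OF y(2), of uminus] by simp
  ultimately show "k = 1" using assms unfolding primitive_in_def by blast
qed

context fano_vertices
begin

text \<open>The new vertices other than \<open>r\<close> all have the height of \<open>p\<close>, so the facet opposite \<open>r\<close> has
  the opposite normal.\<close>

lemma mut_normal_root:
  assumes "p \<in> V" "r \<in> V - {p}" "adm p"
  shows "facet_normal N (convex hull (mut p r ` V)) (convex hull (mut p r ` V - {r})) = - fnormal p" (is ?A)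
    and "of_int (facet_dist N (convex hull (mut p r ` V)) (convex hull (mut p r ` V - {r})))
         = ratio p * of_int (fdist p)" (is ?B)
proof -
  interpret M: fano_vertices N "mut p r ` V" "mut_beta p r" by (rule mut_fano[OF assms])
  let ?h = "ratio p * of_int (fdist p)"
  have h0: "?h > 0" using ratio_pos fdist_pos assms by simp
  have rV: "r \<in> mut p r ` V" using imageI[OF assms(1), of "mut p r"] by simp
  have diff: "mut p r ` V - {r} = mut p r ` (V - {p})" using mut_image_diff[OF assms(1,2,1)] by simp
  have val: "- fnormal p \<bullet> y = ?h" if y: "y \<in> mut p r ` V - {r}" for y
  proof -
    obtain x where "x \<in> V - {p}" "y = mut p r x" using y unfolding diff by blast
    then show ?thesis using fnormal_mut[OF assms(1,2)] by simp
  qed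
  have prim: "primitive_in (dual_lattice N) (- fnormal p)"
    using primitive_fnormal[OF assms(1)] by (rule primitive_dual_uminus)
  show A: ?A using prim val h0 by (rule M.facet_normal_eqI[OF rV])
  have "M.fdist r = \<lfloor>?h\<rfloor>"
    using val height_eq_int[OF assms(1)] by (intro M.facet_dist_eqI[OF rV]) (simp add: A)
  then show ?B using height_eq_int[OF assms(1)] by simp
qed

text \<open>A facet opposite \<open>q\<close> contains both \<open>p\<close> and \<open>r\<close>, so its equation is satisfied by
  \<open>p + t (x - r)\<close> as well.\<close>

lemma mut_normal_other:
  assumes "p \<in> V" "r \<in> V - {p}" "adm p" "q \<in> V - {p, r}"
  shows "facet_normal N (convex hull (mut p r ` V)) (convex hull (mut p r ` V - {mut p r q})) = fnormal q" (is ?A)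
    and "facet_dist N (convex hull (mut p r ` V)) (convex hull (mut p r ` V - {mut p r q})) = fdist q" (is ?B)
proof -
  interpret M: fano_vertices N "mut p r ` V" "mut_beta p r" by (rule mut_fano[OF assms(1-3)])
  have q: "q \<in> V" "mut p r q \<in> mut p r ` V" using assms by auto
  have val: "fnormal q \<bullet> y = of_int (fdist q)" if y: "y \<in> mut p r ` V - {mut p r q}" for y
  proof -
    obtain x where x: "x \<in> V - {q}" "y = mut p r x"
      using y unfolding mut_image_diff[OF assms(1,2) q(1)] by blast
    then show ?thesis using fnormal_facet[OF q(1)] assms
      by (cases "x = p") (auto simp: mut_base inner_add_right inner_diff_right)
  qed
  show A: ?A
    using primitive_fnormal[OF q(1)] val fdist_pos[OF q(1)] by (intro M.facet_normal_eqI[OF q(2), of _ "of_int (fdist q)"]) auto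
  show ?B using val by (intro M.facet_dist_eqI[OF q(2)]) (simp add: A)
qed

text \<open>The edges of the new facet are multiples of the edges of the old one by the quotient of the
  distances.\<close>

lemma adm_mut_root:
  assumes "p \<in> V" "r \<in> V - {p}" "adm p"
  shows "fano_vertices.adm N (mut p r ` V) r"
proof -
  interpret M: fano_vertices N "mut p r ` V" "mut_beta p r" by (rule mut_fano[OF assms])
  let ?h = "ratio p * of_int (fdist p)"
  have h0: "?h > 0" using ratio_pos fdist_pos assms by simp
  have diff: "mut p r ` V - {r} = mut p r ` (V - {p})" using mut_image_diff[OF assms(1,2,1)] by simp
  show ?thesis
  proof (rule M.admI[of p], unfold mut_normal_root(2)[OF assms])
    show "p \<in> mut p r ` V - {r}" unfolding diff using assms by (intro image_eqI[of _ _ r]) auto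
    fix y assume "y \<in> mut p r ` V - {r}"
    then obtain x where x: "x \<in> V - {p}" "y = mut p r x" unfolding diff by blast
    obtain g where g: "g \<in> N" "x - r = of_int (fdist p) *\<^sub>R g"
      using mut_edge_lattice[OF assms x(1)] by metis
    have "y - p = ?h *\<^sub>R g" using x g by (simp add: mut_base)
    then show "(1 / ?h) *\<^sub>R (y - p) \<in> N" using h0 g by (simp add: lattice_zero[OF lattice])
  qed
qed

text \<open>For an edge \<open>x - r = d g\<close> of the facet opposite \<open>p\<close>, the corresponding new edge is \<open>h g\<close>. When the
  edge from \<open>r\<close> to \<open>p\<close> is divisible by the distance \<open>d'\<close> of the facet opposite \<open>q\<close>, its height shows
  that \<open>d'\<close> divides \<open>h + d\<close>, so \<open>d g\<close> and \<open>h g\<close> are divisible by \<open>d'\<close> simultaneously.\<close>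

lemma adm_mut_other:
  assumes "p \<in> V" "r \<in> V - {p}" "adm p" "q \<in> V - {p, r}"
  shows "fano_vertices.adm N (mut p r ` V) (mut p r q) \<longleftrightarrow> adm q"
proof -
  interpret M: fano_vertices N "mut p r ` V" "mut_beta p r" by (rule mut_fano[OF assms(1-3)])
  let ?d = "real_of_int (fdist q)" and ?h = "ratio p * of_int (fdist p)"
  have q: "q \<in> V" using assms by simp
  have d0: "?d > 0" using fdist_pos[OF q] by simp
  have diff: "mut p r ` V - {mut p r q} = mut p r ` (V - {q})" using mut_image_diff[OF assms(1,2) q] .
  note dist = mut_normal_other(2)[OF assms, unfolded diff]
  \<comment> \<open>The height of the edge from \<open>r\<close> to \<open>p\<close> is \<open>- (h + d)\<close>.\<close>
  have key: "(1 / ?d) *\<^sub>R (x - r) \<in> N \<longleftrightarrow> (1 / ?d) *\<^sub>R (mut p r x - p) \<in> N"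
    if pr: "(1 / ?d) *\<^sub>R (p - r) \<in> N" and x: "x \<in> V - {p}" for x
  proof -
    obtain g where g: "g \<in> N" "x - r = of_int (fdist p) *\<^sub>R g"
      using mut_edge_lattice[OF assms(1-3) x] by metis
    have e: "mut p r x - p = ?h *\<^sub>R g" using x g by (simp add: mut_base)
    have "fnormal p \<bullet> ((1 / ?d) *\<^sub>R (p - r)) = - (1 / ?d) * (?h + of_int (fdist p))"
      using fnormal_opposite[OF assms(1)] fnormal_facet[OF assms(1,2)] by (simp add: inner_diff_right algebra_simps)
    then have "- (1 / ?d) * (?h + of_int (fdist p)) \<in> \<int>"
      using fnormal_int[OF assms(1) pr] by simp
    then have "(- (- (1 / ?d) * (?h + of_int (fdist p)))) *\<^sub>R g \<in> N"
      using g by (intro lattice_scale[OF lattice] Ints_minus)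
    also have "(- (- (1 / ?d) * (?h + of_int (fdist p)))) *\<^sub>R g
        = (1 / ?d) *\<^sub>R (x - r) + (1 / ?d) *\<^sub>R (mut p r x - p)"
      unfolding e g(2) by (simp add: algebra_simps add_divide_distrib)
    finally have s: "(1 / ?d) *\<^sub>R (x - r) + (1 / ?d) *\<^sub>R (mut p r x - p) \<in> N" .
    show ?thesis
      using lattice_diff[OF lattice s, of "(1 / ?d) *\<^sub>R (x - r)"]
        lattice_diff[OF lattice s, of "(1 / ?d) *\<^sub>R (mut p r x - p)"] by auto
  qed
  have mp: "p \<in> V - {q}" "r \<in> V - {q}" using assms by auto
  show ?thesis
  proof
    assume a: "M.adm (mut p r q)"
    have "r \<in> mut p r ` (V - {q})" "p \<in> mut p r ` (V - {q})"
      using mp assms(2) by (auto intro: image_eqI[of _ _ p] image_eqI[of _ _ r])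
    then have pr: "(1 / ?d) *\<^sub>R (p - r) \<in> N" and
      e: "\<And>x. x \<in> V - {q} \<Longrightarrow> (1 / ?d) *\<^sub>R (mut p r x - p) \<in> N"
      using a unfolding M.adm_def diff dist by blast+
    show "adm q"
    proof (rule admI[OF mp(2)])
      fix x assume "x \<in> V - {q}"
      then show "(1 / ?d) *\<^sub>R (x - r) \<in> N" using pr e key[OF pr] by (cases "x = p") auto
    qed
  next
    assume a: "adm q"
    then have pr: "(1 / ?d) *\<^sub>R (p - r) \<in> N" using mp unfolding adm_def by blast
    show "M.adm (mut p r q)"
    proof (rule M.admI[of p], unfold diff dist)
      show "p \<in> mut p r ` (V - {q})" using mp assms(2) by (intro image_eqI[of _ _ r]) auto
      fix y assume "y \<in> mut p r ` (V - {q})"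
      then obtain x where x: "x \<in> V - {q}" "y = mut p r x" by blast
      show "(1 / ?d) *\<^sub>R (y - p) \<in> N"
      proof (cases "x = p")
        case True
        have "(1 / ?d) *\<^sub>R (r - p) \<in> N" using a mp unfolding adm_def by blast
        then show ?thesis using True x by simp
      next
        case False
        then show ?thesis using x key[OF pr] a mp unfolding adm_def by blast
      qed
    qed
  qed
qed

end

section \<open>Unimodular equivalence\<close>

lemma GL_linear: "g \<in> GL N \<Longrightarrow> linear g"
  and GL_inj: "g \<in> GL N \<Longrightarrow> inj g"
  and GL_lattice: "g \<in> GL N \<Longrightarrow> x \<in> N \<Longrightarrow> g x \<in> N"
  by (auto simp: GL_def bij_def)

lemma GL_comp: "g \<in> GL N \<Longrightarrow> h \<in> GL N \<Longrightarrow> g \<circ> h \<in> GL N"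
  unfolding GL_def by (simp add: linear_compose bij_comp image_comp[of g h N, symmetric] del: o_apply image_comp)

lemma GL_inv:
  assumes "g \<in> GL N" shows "inv g \<in> GL N"
proof -
  have g: "linear g" "bij g" "g ` N = N" using assms by (auto simp: GL_def)
  have "inv g ` N = inv g ` (g ` N)" using g by simp
  also have "\<dots> = N" using bij_is_inj[OF g(2)] by (rule image_inv_f_f)
  finally show ?thesis
    using g by (simp add: GL_def bij_imp_bij_inv inj_linear_imp_inv_linear bij_is_inj)
qed

lemma GL_lattice_iff: "g \<in> GL N \<Longrightarrow> g x \<in> N \<longleftrightarrow> x \<in> N"
  using GL_lattice[of g N] GL_lattice[OF GL_inv, of g N "g x"] inv_f_f[OF GL_inj] by metis

lemma GL_hull: "g \<in> GL N \<Longrightarrow> g ` (convex hull S) = convex hull (g ` S)"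
  by (simp add: convex_hull_linear_image GL_linear)

lemma unimod_class_image:
  assumes "g \<in> GL N" shows "unimod_class N (g ` P) = unimod_class N P"
proof (intro equalityI subsetI)
  fix Q assume "Q \<in> unimod_class N (g ` P)"
  then obtain h where "h \<in> GL N" "Q = (h \<circ> g) ` P" by (auto simp: unimod_class_def image_comp)
  then show "Q \<in> unimod_class N P" using GL_comp assms unfolding unimod_class_def by blast
next
  fix Q assume "Q \<in> unimod_class N P"
  then obtain h where h: "h \<in> GL N" "Q = h ` P" by (auto simp: unimod_class_def)
  then have "Q = (h \<circ> inv g) ` (g ` P)" using GL_inj[OF assms] by (simp add: image_comp comp_assoc)
  then show "Q \<in> unimod_class N (g ` P)" using GL_comp[OF h(1) GL_inv[OF assms]] unfolding unimod_class_def by blast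
qed

context fano_vertices
begin

lemma GL_fano:
  assumes g: "g \<in> GL N"
  shows "fano_vertices N (g ` V) (\<beta> \<circ> inv g)"
proof
  have inj: "inj_on g V" "inv g (g x) = x" for x using GL_inj[OF g] by (auto intro: inj_on_subset)
  show "full_lattice N" "finite (g ` V)" using lattice fin by auto
  show "card (g ` V) = DIM('a) + 1" using card_image[OF inj(1)] card_V by simp
  show "\<not> affine_dependent (g ` V)"
  proof
    assume "affine_dependent (g ` V)"
    then obtain U where U: "sum U (g ` V) = 0" "\<exists>y\<in>g ` V. U y \<noteq> 0" "(\<Sum>y\<in>g ` V. U y *\<^sub>R y) = 0"
      using affine_dependent_explicit_finite[of "g ` V"] fin by auto
    have "g (\<Sum>x\<in>V. U (g x) *\<^sub>R x) = g 0"
      using U(3) GL_linear[OF g] by (simp add: sum.reindex[OF inj(1)] linear_sum linear_scale linear_0)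
    then have "(\<Sum>x\<in>V. U (g x) *\<^sub>R x) = 0" using GL_inj[OF g] by (rule injD[rotated])
    then have "affine_dependent V"
      using U(1,2) unfolding affine_dependent_explicit_finite[OF fin]
      by (intro exI[of _ "\<lambda>x. U (g x)"]) (auto simp: sum.reindex[OF inj(1)])
    then show False using aff_indep by simp
  qed
  show "sum (\<beta> \<circ> inv g) (g ` V) = 1" by (simp add: sum.reindex[OF inj(1)] inj sum_beta)
  have "(\<Sum>x\<in>g ` V. (\<beta> \<circ> inv g) x *\<^sub>R x) = (\<Sum>x\<in>V. g (\<beta> x *\<^sub>R x))"
    by (simp add: sum.reindex[OF inj(1)] inj linear_scale[OF GL_linear[OF g]])
  also have "\<dots> = 0" using linear_sum[OF GL_linear[OF g], of "\<lambda>x. \<beta> x *\<^sub>R x" V] bary linear_0[OF GL_linear[OF g]] by simp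
  finally show "(\<Sum>x\<in>g ` V. (\<beta> \<circ> inv g) x *\<^sub>R x) = 0" .
  show "(\<beta> \<circ> inv g) x > 0" if "x \<in> g ` V" for x using that pos inj by auto
  show "primitive_in N y" if y: "y \<in> g ` V" for y
  proof -
    obtain x where x: "x \<in> V" "y = g x" using y by blast
    note px = prim[OF x(1)]
    have "y \<noteq> 0" using px x linear_0[OF GL_linear[OF g]] GL_inj[OF g] by (metis injD primitive_in_def)
    moreover have "k = 1" if "z \<in> N" "y = real k *\<^sub>R z" for z and k :: nat
    proof -
      have "x = inv g (real k *\<^sub>R z)" using inj x that by simp
      also have "\<dots> = real k *\<^sub>R inv g z" by (rule linear_scale[OF GL_linear[OF GL_inv[OF g]]])
      finally show ?thesis using px GL_lattice[OF GL_inv[OF g] that(1)] unfolding primitive_in_def by blast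
    qed
    ultimately show ?thesis using GL_lattice[OF g] px x(2) by (auto simp: primitive_in_def)
  qed
qed

text \<open>The normal of the image is the image of the normal under the inverse transpose.\<close>

lemma GL_fdist:
  assumes g: "g \<in> GL N" and p: "p \<in> V"
  shows "facet_dist N (convex hull (g ` V)) (convex hull (g ` V - {g p})) = fdist p"
proof -
  interpret G: fano_vertices N "g ` V" "\<beta> \<circ> inv g" by (rule GL_fano[OF g])
  let ?a = "adjoint (inv g)"
  have lin: "linear (inv g)" "linear g" using GL_linear GL_inv g by auto
  have inv: "inv g (g x) = x" for x using GL_inj[OF g] by simp
  have adj: "?a u \<bullet> x = u \<bullet> inv g x" for u x
    using adjoint_works[OF lin(1), of x u] by (simp add: inner_commute)
  have dual: "?a u \<in> dual_lattice N" if "u \<in> dual_lattice N" for u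
    using that GL_lattice[OF GL_inv[OF g]] by (auto simp: dual_lattice_def adj)
  have diff: "g ` V - {g p} = g ` (V - {p})" using GL_inj[OF g] by (simp add: image_set_diff)
  have val: "?a (fnormal p) \<bullet> y = of_int (fdist p)" if y: "y \<in> g ` V - {g p}" for y
  proof -
    obtain x where "x \<in> V - {p}" "y = g x" using y unfolding diff by blast
    then show ?thesis using fnormal_facet[OF p] by (simp add: adj inv)
  qed
  have prim: "primitive_in (dual_lattice N) (?a (fnormal p))"
    unfolding primitive_in_def
  proof (intro conjI ballI allI impI)
    note n = primitive_fnormal[OF p]
    show "?a (fnormal p) \<in> dual_lattice N" using n by (intro dual) (auto simp: primitive_in_def)
    obtain q where "q \<in> V - {p}" using facet_ne[OF p] by blast
    then show "?a (fnormal p) \<noteq> 0"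
      using val[of "g q"] fdist_pos[OF p] unfolding diff by auto
    fix y and k :: nat assume y: "y \<in> dual_lattice N" "?a (fnormal p) = real k *\<^sub>R y"
    have "adjoint g y \<bullet> x = y \<bullet> g x" for x
      using adjoint_works[OF lin(2), of x y] by (simp add: inner_commute)
    note adg = this
    have "adjoint g y \<in> dual_lattice N" using y GL_lattice[OF g] by (auto simp: dual_lattice_def adg)
    moreover have "fnormal p = real k *\<^sub>R adjoint g y"
    proof (rule vector_eq_rdot[THEN iffD1], rule allI)
      fix x
      have "fnormal p \<bullet> x = ?a (fnormal p) \<bullet> g x" by (simp add: adj inv)
      also have "\<dots> = real k * (y \<bullet> g x)" by (simp add: y(2))
      finally show "fnormal p \<bullet> x = real k *\<^sub>R adjoint g y \<bullet> x" by (simp add: adg)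
    qed
    ultimately show "k = 1" using n unfolding primitive_in_def by blast
  qed
  have n: "G.fnormal (g p) = ?a (fnormal p)"
    using prim val fdist_pos[OF p] p by (intro G.facet_normal_eqI[of _ _ "of_int (fdist p)"]) auto
  show ?thesis using val p by (intro G.facet_dist_eqI) (simp_all add: n)
qed

lemma GL_adm:
  assumes g: "g \<in> GL N" and p: "p \<in> V"
  shows "fano_vertices.adm N (g ` V) (g p) \<longleftrightarrow> adm p"
proof -
  interpret G: fano_vertices N "g ` V" "\<beta> \<circ> inv g" by (rule GL_fano[OF g])
  have diff: "g ` V - {g p} = g ` (V - {p})" using GL_inj[OF g] by (simp add: image_set_diff)
  have "(1 / d) *\<^sub>R (g x - g y) = g ((1 / d) *\<^sub>R (x - y))" for d x y
    using GL_linear[OF g] by (simp add: linear_scale linear_diff)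
  then show ?thesis
    unfolding G.adm_def adm_def diff GL_fdist[OF g p, unfolded diff] using GL_lattice_iff[OF g] by simp
qed

lemma GL_mut:
  assumes g: "g \<in> GL N"
  shows "fano_vertices.mut (\<beta> \<circ> inv g) (g p) (g r) (g x) = g (mut p r x)"
proof -
  interpret G: fano_vertices N "g ` V" "\<beta> \<circ> inv g" by (rule GL_fano[OF g])
  have inv: "inv g (g x) = x" "g x = g y \<longleftrightarrow> x = y" for x y using GL_inj[OF g] by (auto dest: injD)
  have "G.ratio (g p) = ratio p" by (simp add: G.ratio_def ratio_def inv)
  then show ?thesis
    using GL_linear[OF g] by (simp add: G.mut_def mut_def inv linear_add linear_diff linear_scale)
qed

end

section \<open>Invariance of the number of admissible facets\<close>

context fano_vertices
begin

text \<open>The shear that fixes all vectors of height 0 and translates the facet by \<open>s - r\<close>; it is integral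
  because the facet is admissible.\<close>

lemma mut_shear:
  assumes p: "p \<in> V" "adm p" and r: "r \<in> V - {p}" and s: "s \<in> V - {p}"
  obtains g where "g \<in> GL N" "\<And>x. x \<in> V \<Longrightarrow> g (mut p r x) = mut p s x"
proof -
  obtain u where u: "u \<in> N" "s - r = of_int (fdist p) *\<^sub>R u" "fnormal p \<bullet> u = 0"
    using mut_edge_lattice[OF p(1) r p(2) s] by blast
  define g where "g x = x + (fnormal p \<bullet> x) *\<^sub>R u" for x
  define h where "h x = x - (fnormal p \<bullet> x) *\<^sub>R u" for x
  have gh: "g (h x) = x" "h (g x) = x" for x by (simp_all add: g_def h_def inner_add_right inner_diff_right u)
  have gN: "g x \<in> N" "h x \<in> N" if "x \<in> N" for x
    unfolding g_def h_def using that fnormal_int[OF p(1) that] u(1)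
    by (auto intro!: lattice_add[OF lattice] lattice_diff[OF lattice] lattice_scale[OF lattice])
  have "g ` N = N" using gN gh by (metis image_eqI subsetI subset_antisym image_subsetI)
  moreover have "linear g" by (rule linearI) (simp_all add: g_def inner_add_right algebra_simps)
  moreover have "bij g" using gh by (metis bijI' )
  ultimately have "g \<in> GL N" by (simp add: GL_def)
  moreover have "g (mut p r x) = mut p s x" if "x \<in> V" for x
  proof (cases "x = p")
    case True
    then show ?thesis using fnormal_facet[OF p(1) r] u(2) by (simp add: g_def) (metis add.commute diff_add_cancel)
  next
    case False
    then have "g (mut p r x) = p + ratio p *\<^sub>R (x - r) - ratio p *\<^sub>R (of_int (fdist p) *\<^sub>R u)"
      using fnormal_mut[OF p(1) r, of x] that by (simp add: g_def mut_base)
    also have "\<dots> = mut p s x" using False by (simp add: mut_base u(2)[symmetric] algebra_simps)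
    finally show ?thesis .
  qed
  ultimately show ?thesis using that by blast
qed

text \<open>The facet opposite \<open>r\<close> is compared with its image via the mutation at a third vertex \<open>s\<close>.\<close>

lemma adm_mut:
  assumes p: "p \<in> V" "adm p" and r: "r \<in> V - {p}" and x: "x \<in> V"
  shows "fano_vertices.adm N (mut p r ` V) (mut p r x) \<longleftrightarrow> adm x"
proof -
  interpret M: fano_vertices N "mut p r ` V" "mut_beta p r" by (rule mut_fano[OF p(1) r p(2)])
  consider "x = p" | "x \<in> V - {p, r}" | "x = r" using x by blast
  then show ?thesis
  proof cases
    case 1 then show ?thesis using adm_mut_root[OF p(1) r p(2)] p by simp
  next
    case 2 then show ?thesis using adm_mut_other[OF p(1) r p(2)] by simp
  next
    case 3
    show ?thesis
    proof (cases "V - {p, r} = {}")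
      case True
      \<comment> \<open>In dimension one every facet is a point.\<close>
      then have V: "V - {r} = {p}" using p(1) r by blast
      have "mut p r ` V - {mut p r r} = {r}" unfolding mut_image_diff[OF p(1) r DiffD1[OF r]] V by simp
      then show ?thesis unfolding 3 M.adm_def adm_def V by (simp add: lattice_zero[OF lattice])
    next
      case False
      then obtain s where s: "s \<in> V - {p}" "r \<in> V - {p, s}" using r by blast
      obtain g where g: "g \<in> GL N" "\<And>x. x \<in> V \<Longrightarrow> g (mut p r x) = mut p s x"
        using mut_shear[OF p r s(1)] by blast
      have "g ` mut p r ` V = mut p s ` V" using g(2) by (auto simp: image_image)
      moreover have rV: "r \<in> V" using r by simp
      ultimately have "fano_vertices.adm N (mut p s ` V) (mut p s r) \<longleftrightarrow> M.adm (mut p r r)"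
        using M.GL_adm[OF g(1) imageI[OF rV]] unfolding g(2)[OF rV] by simp
      then show ?thesis
        using adm_mut_other[OF p(1) s(1) p(2)] s r unfolding 3 by blast
    qed
  qed
qed

lemma ad_mut:
  assumes p: "p \<in> V" "adm p" and r: "r \<in> V - {p}"
  shows "ad N (convex hull (mut p r ` V)) = ad N (convex hull V)"
proof -
  interpret M: fano_vertices N "mut p r ` V" "mut_beta p r" by (rule mut_fano[OF p(1) r p(2)])
  have "{y \<in> mut p r ` V. M.adm y} = mut p r ` {x \<in> V. adm x}"
    using adm_mut[OF p r] by auto
  then have "card {y \<in> mut p r ` V. M.adm y} = card {x \<in> V. adm x}"
    using card_image[OF inj_on_subset[OF mut_inj[OF p(1) r]], of "{x \<in> V. adm x}"] by simp
  then show ?thesis by (simp add: ad_eq M.ad_eq)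
qed

lemma finite_admissible: "finite {F. admissible N (convex hull V) F}"
proof -
  have "{F. admissible N (convex hull V) F} \<subseteq> (\<lambda>p. convex hull (V - {p})) ` V"
    by (auto simp: admissible_iff)
  then show ?thesis using fin finite_surj by blast
qed

end

text \<open>The passage from polytopes and facets to vertex sets.\<close>

lemma admissibleE:
  fixes N P :: "'a::euclidean_space set"
  assumes "full_lattice N" "fano_simplex N P" "admissible N P F"
  obtains V \<beta> p where "fano_vertices N V \<beta>" "P = convex hull V" "p \<in> V" "F = convex hull (V - {p})"
    "fano_vertices.adm N V p" "{v. v extreme_point_of F} = V - {p}" "V - {p} \<noteq> {}"
    "\<And>v. v \<in> V - {p} \<Longrightarrow> facet_mutation N P F v = convex hull (fano_vertices.mut \<beta> p v ` V)"
proof -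
  obtain V \<beta> where V: "fano_vertices N V \<beta>" "P = convex hull V"
    using fano_simplexE[OF assms(1,2)] by blast
  interpret fano_vertices N V \<beta> by fact
  obtain p where p: "p \<in> V" "adm p" "F = convex hull (V - {p})"
    using assms(3) unfolding V(2) admissible_iff by blast
  show ?thesis
    using that[OF V p(1,3,2)] facet_ne[OF p(1)] facet_mutation_eq[OF p(1)] extreme_point_facet
    unfolding V(2) p(3) by blast
qed

context
  fixes N :: "'a::euclidean_space set"
  assumes N: "full_lattice N"
begin

lemma fano_simplex_facet_mutation:
  assumes "fano_simplex N P" "admissible N P F" "v extreme_point_of F"
  shows "fano_simplex N (facet_mutation N P F v)" "ad N (facet_mutation N P F v) = ad N P"
proof -
  obtain V \<beta> p where *: "fano_vertices N V \<beta>" "P = convex hull V" "p \<in> V" "F = convex hull (V - {p})"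
    "fano_vertices.adm N V p" "{v. v extreme_point_of F} = V - {p}"
    "\<And>v. v \<in> V - {p} \<Longrightarrow> facet_mutation N P F v = convex hull (fano_vertices.mut \<beta> p v ` V)"
    using admissibleE[OF N assms(1,2)] by metis
  interpret fano_vertices N V \<beta> by fact
  have v: "v \<in> V - {p}" using * assms(3) by blast
  interpret M: fano_vertices N "mut p v ` V" "mut_beta p v" by (rule mut_fano[OF *(3) v *(5)])
  show "fano_simplex N (facet_mutation N P F v)" unfolding *(7)[OF v] by (rule M.fano_simplex)
  show "ad N (facet_mutation N P F v) = ad N P" unfolding *(7)[OF v] unfolding *(2) by (rule ad_mut[OF *(3,5) v])
qed

lemma facet_mutation_vertex_choice:
  assumes "fano_simplex N P" "admissible N P F" "v extreme_point_of F" "w extreme_point_of F"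
  shows "unimod_class N (facet_mutation N P F w) = unimod_class N (facet_mutation N P F v)"
proof -
  obtain V \<beta> p where *: "fano_vertices N V \<beta>" "P = convex hull V" "p \<in> V" "F = convex hull (V - {p})"
    "fano_vertices.adm N V p" "{v. v extreme_point_of F} = V - {p}"
    "\<And>v. v \<in> V - {p} \<Longrightarrow> facet_mutation N P F v = convex hull (fano_vertices.mut \<beta> p v ` V)"
    using admissibleE[OF N assms(1,2)] by metis
  interpret fano_vertices N V \<beta> by fact
  have vw: "v \<in> V - {p}" "w \<in> V - {p}" using * assms(3,4) by blast+
  obtain g where g: "g \<in> GL N" "\<And>x. x \<in> V \<Longrightarrow> g (mut p v x) = mut p w x"
    using mut_shear[OF *(3,5) vw] by blast
  have "g ` mut p v ` V = mut p w ` V" using g(2) by (auto simp: image_image)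
  then have "facet_mutation N P F w = g ` facet_mutation N P F v"
    using *(7) vw by (simp add: GL_hull[OF g(1)])
  then show ?thesis using unimod_class_image[OF g(1)] by simp
qed

lemma facet_mutation_reversible:
  assumes "fano_simplex N P" "admissible N P F" "v extreme_point_of F"
  obtains F' w where "admissible N (facet_mutation N P F v) F'" "w extreme_point_of F'"
    "facet_mutation N (facet_mutation N P F v) F' w = P"
proof -
  obtain V \<beta> p where *: "fano_vertices N V \<beta>" "P = convex hull V" "p \<in> V" "F = convex hull (V - {p})"
    "fano_vertices.adm N V p" "{v. v extreme_point_of F} = V - {p}"
    "\<And>v. v \<in> V - {p} \<Longrightarrow> facet_mutation N P F v = convex hull (fano_vertices.mut \<beta> p v ` V)"
    using admissibleE[OF N assms(1,2)] by metis
  interpret fano_vertices N V \<beta> by fact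
  have v: "v \<in> V - {p}" using * assms(3) by blast
  interpret M: fano_vertices N "mut p v ` V" "mut_beta p v" by (rule mut_fano[OF *(3) v *(5)])
  have vV: "v \<in> mut p v ` V" using imageI[OF *(3), of "mut p v"] by simp
  have pV: "p \<in> mut p v ` V - {v}"
  proof -
    have "mut p v v \<in> mut p v ` V" using v by (intro imageI) simp
    then show ?thesis using v by auto
  qed
  have "M.mut v p ` mut p v ` V = V"
    using mut_mut[OF *(3) v *(5)] by (simp add: image_image)
  then have "facet_mutation N (convex hull (mut p v ` V)) (convex hull (mut p v ` V - {v})) p = P"
    using M.facet_mutation_eq[OF vV pV] *(2) by simp
  moreover have "admissible N (convex hull (mut p v ` V)) (convex hull (mut p v ` V - {v}))"
    using M.admissible_facet_iff[OF vV] adm_mut_root[OF *(3) v *(5)] by simp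
  ultimately show ?thesis using that M.extreme_point_facet pV unfolding *(7)[OF v] by blast
qed

lemma GL_fano_simplex:
  assumes g: "g \<in> GL N" and P: "fano_simplex N P"
  shows "fano_simplex N (g ` P)"
proof -
  obtain V \<beta> where V: "fano_vertices N V \<beta>" "P = convex hull V" using fano_simplexE[OF N P] by blast
  interpret fano_vertices N V \<beta> by fact
  interpret G: fano_vertices N "g ` V" "\<beta> \<circ> inv g" by (rule GL_fano[OF g])
  show ?thesis unfolding V(2) GL_hull[OF g] by (rule G.fano_simplex)
qed

lemma GL_facet_mutation:
  assumes g: "g \<in> GL N" and "fano_simplex N P" "admissible N P F"
  shows GL_admissible: "admissible N (g ` P) (g ` F)"
    and "v extreme_point_of F \<Longrightarrow> g v extreme_point_of g ` F"
    and "v extreme_point_of F \<Longrightarrow> facet_mutation N (g ` P) (g ` F) (g v) = g ` facet_mutation N P F v"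
proof -
  obtain V \<beta> p where *: "fano_vertices N V \<beta>" "P = convex hull V" "p \<in> V" "F = convex hull (V - {p})"
    "fano_vertices.adm N V p" "{v. v extreme_point_of F} = V - {p}"
    "\<And>v. v \<in> V - {p} \<Longrightarrow> facet_mutation N P F v = convex hull (fano_vertices.mut \<beta> p v ` V)"
    using admissibleE[OF N assms(2,3)] by metis
  interpret fano_vertices N V \<beta> by fact
  interpret G: fano_vertices N "g ` V" "\<beta> \<circ> inv g" by (rule GL_fano[OF g])
  have gV: "g ` V - {g p} = g ` (V - {p})" using GL_inj[OF g] by (simp add: image_set_diff)
  have gP: "g ` P = convex hull (g ` V)" and gF: "g ` F = convex hull (g ` V - {g p})"
    unfolding *(2,4) gV GL_hull[OF g] by simp_all
  have gp: "g p \<in> g ` V" using *(3) by simp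
  show "admissible N (g ` P) (g ` F)"
    unfolding gP gF using G.admissible_facet_iff[OF gp] GL_adm[OF g *(3)] *(5) by simp
  show "g v extreme_point_of g ` F" if "v extreme_point_of F"
  proof -
    have "v \<in> {v. v extreme_point_of F}" using that by simp
    then show ?thesis unfolding gF G.extreme_point_facet unfolding gV *(6) by (rule imageI)
  qed
  show "facet_mutation N (g ` P) (g ` F) (g v) = g ` facet_mutation N P F v" if v: "v extreme_point_of F"
  proof -
    have v: "v \<in> V - {p}" using *(6) v by blast
    then have "g v \<in> g ` V - {g p}" unfolding gV by blast
    from G.facet_mutation_eq[OF gp this]
    show ?thesis unfolding gP gF *(7)[OF v] GL_hull[OF g] by (simp add: image_image GL_mut[OF g])
  qed
qed

lemma GL_admissible_iff:
  assumes g: "g \<in> GL N" and P: "fano_simplex N P"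
  shows "admissible N (g ` P) (g ` F) \<longleftrightarrow> admissible N P F"
proof
  have inv: "inv g ` g ` X = X" for X using GL_inj[OF g] by (rule image_inv_f_f)
  assume "admissible N (g ` P) (g ` F)"
  from GL_admissible[OF GL_inv[OF g] GL_fano_simplex[OF g P] this] show "admissible N P F"
    unfolding inv .
qed (rule GL_admissible[OF g P])

lemma GL_admissible_bij:
  assumes g: "g \<in> GL N" and P: "fano_simplex N P"
  shows "bij_betw ((`) g) {F. admissible N P F} {F. admissible N (g ` P) F}"
proof (rule bij_betw_byWitness[where f' = "(`) (inv g)"])
  have inv: "inv g ` g ` X = X" "g ` inv g ` X = X" for X
    using GL_inj[OF g] g by (auto simp: image_inv_f_f GL_def bij_def image_f_inv_f)
  show "\<forall>F\<in>{F. admissible N P F}. inv g ` g ` F = F"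
    "\<forall>F\<in>{F. admissible N (g ` P) F}. g ` inv g ` F = F" using inv by auto
  show "(`) g ` {F. admissible N P F} \<subseteq> {F. admissible N (g ` P) F}" using GL_admissible[OF g P] by auto
  show "(`) (inv g) ` {F. admissible N (g ` P) F} \<subseteq> {F. admissible N P F}"
    using GL_admissible_iff[OF g P] inv(2) by (auto, metis)
qed

lemma GL_ad: "g \<in> GL N \<Longrightarrow> fano_simplex N P \<Longrightarrow> ad N (g ` P) = ad N P"
  unfolding ad_def using bij_betw_same_card[OF GL_admissible_bij] by metis

lemma finite_admissible_facets: "fano_simplex N P \<Longrightarrow> finite {F. admissible N P F}"
  using fano_simplexE[OF N] fano_vertices.finite_admissible by metis

section \<open>The exchange graph of a mutation class\<close>

lemma mutation_reachable:
  assumes P: "fano_simplex N P" and "(mutates_to N)\<^sup>*\<^sup>* P R"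
  shows "fano_simplex N R \<and> ad N R = ad N P"
  using assms(2)
proof induction
  case base show ?case using P by simp
next
  case (step Q R)
  then show ?case using fano_simplex_facet_mutation[of Q] unfolding mutates_to_def by auto
qed

lemma mutation_class_member:
  assumes P: "fano_simplex N P" and C: "C \<in> mutation_class N P" and R: "R \<in> C"
  shows "fano_simplex N R" "C = unimod_class N R" "ad N R = ad N P"
proof -
  obtain Q where Q: "C = unimod_class N Q" "(mutates_to N)\<^sup>*\<^sup>* P Q"
    using C by (auto simp: mutation_class_def)
  then obtain g where g: "g \<in> GL N" "R = g ` Q" using R by (auto simp: unimod_class_def)
  have fQ: "fano_simplex N Q" "ad N Q = ad N P" using mutation_reachable[OF P Q(2)] by auto
  show "fano_simplex N R" "C = unimod_class N R" "ad N R = ad N P"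
    using GL_fano_simplex[OF g(1) fQ(1)] unimod_class_image[OF g(1)] GL_ad[OF g(1) fQ(1)] Q g fQ by auto
qed

text \<open>The given representative \<open>R\<close> need not itself be obtained from \<open>P\<close> by mutations, so the mutation
  is transported to a member \<open>Q\<close> of the same class that is.\<close>

lemma mutation_class_step:
  assumes P: "fano_simplex N P" and C: "C \<in> mutation_class N P" and R: "R \<in> C"
    and F: "admissible N R F" "v extreme_point_of F"
  shows "unimod_class N (facet_mutation N R F v) \<in> mutation_class N P"
proof -
  obtain Q where Q: "C = unimod_class N Q" "(mutates_to N)\<^sup>*\<^sup>* P Q"
    using C by (auto simp: mutation_class_def)
  then obtain g where g: "g \<in> GL N" "R = g ` Q" using R by (auto simp: unimod_class_def)
  let ?h = "inv g"
  have h: "?h \<in> GL N" "?h ` R = Q" using GL_inv[OF g(1)] GL_inj[OF g(1)] g(2) by (auto simp: image_inv_f_f)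
  note gm = GL_facet_mutation[OF h(1) mutation_class_member(1)[OF P C R] F(1)]
  have "mutates_to N Q (?h ` facet_mutation N R F v)"
    unfolding mutates_to_def using gm(1) gm(2,3)[OF F(2)] unfolding h(2) by (metis (no_types))
  then have "(mutates_to N)\<^sup>*\<^sup>* P (?h ` facet_mutation N R F v)" using Q(2) by simp
  then show ?thesis
    using unimod_class_image[OF h(1), of "facet_mutation N R F v"] unfolding mutation_class_def by blast
qed

context
  fixes P rep
  assumes P: "fano_simplex N P" and rep: "\<forall>C\<in>mutation_class N P. rep C \<in> C"
begin

lemma rep_fano: "C \<in> mutation_class N P \<Longrightarrow> fano_simplex N (rep C)"
  and rep_class: "C \<in> mutation_class N P \<Longrightarrow> unimod_class N (rep C) = C"
  using mutation_class_member[OF P] rep by auto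

lemma facet_graph_head:
  assumes C: "C \<in> mutation_class N P" and F: "admissible N (rep C) F" "v extreme_point_of F"
  shows "head (facet_graph N P rep) (C, F) = unimod_class N (facet_mutation N (rep C) F v)"
proof -
  have "(\<Union>w\<in>{w. w extreme_point_of F}. unimod_class N (facet_mutation N (rep C) F w))
      = unimod_class N (facet_mutation N (rep C) F v)"
  proof (rule SUP_eq_const)
    show "{w. w extreme_point_of F} \<noteq> {}" using F(2) by blast
  qed (simp add: facet_mutation_vertex_choice[OF rep_fano[OF C] F])
  then show ?thesis by (simp add: facet_graph_def)
qed

lemma admissible_extreme_point:
  assumes "fano_simplex N R" "admissible N R F" obtains v where "v extreme_point_of F"
proof -
  obtain V p where "{v. v extreme_point_of F} = V - {p}" "V - {p} \<noteq> {}"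
    using admissibleE[OF N assms] by metis
  then show ?thesis using that by blast
qed

text \<open>An arc is reversed by the inverse mutation, transported to the representative of the other
  class.\<close>

lemma facet_graph_sym: "sym_digraph (facet_graph N P rep)"
proof -
  let ?G = "facet_graph N P rep"
  have arcs: "arcs ?G = {(C, F). C \<in> mutation_class N P \<and> admissible N (rep C) F}"
    and verts: "verts ?G = mutation_class N P" and tail: "tail ?G = fst"
    by (auto simp: facet_graph_def)
  show ?thesis
  proof (unfold_locales, goal_cases)
    case (1 e) then show ?case by (auto simp: arcs verts tail)
  next
    case (2 e)
    then obtain C F where e: "e = (C, F)" and C: "C \<in> mutation_class N P" and F: "admissible N (rep C) F"
      by (auto simp: arcs)
    obtain v where v: "v extreme_point_of F" using admissible_extreme_point[OF rep_fano[OF C] F] .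
    show ?case unfolding e verts facet_graph_head[OF C F v]
      using mutation_class_step[OF P C _ F v] rep C by blast
  next
    case 3
    show ?case unfolding symmetric_conv
    proof
      fix e assume "e \<in> arcs ?G"
      then obtain C F where e: "e = (C, F)" and C: "C \<in> mutation_class N P" and F: "admissible N (rep C) F"
        by (auto simp: arcs)
      obtain v where v: "v extreme_point_of F" using admissible_extreme_point[OF rep_fano[OF C] F] .
      define Q where "Q = facet_mutation N (rep C) F v"
      define D where "D = unimod_class N Q"
      have hd: "head ?G e = D" unfolding e D_def Q_def by (rule facet_graph_head[OF C F v])
      have D: "D \<in> mutation_class N P"
        unfolding D_def Q_def using mutation_class_step[OF P C _ F v] rep C by blast
      have Q: "fano_simplex N Q" unfolding Q_def by (rule fano_simplex_facet_mutation(1)[OF rep_fano[OF C] F v])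
      obtain F' w where F': "admissible N Q F'" "w extreme_point_of F'" "facet_mutation N Q F' w = rep C"
        using facet_mutation_reversible[OF rep_fano[OF C] F v] unfolding Q_def by blast
      obtain g where g: "g \<in> GL N" "rep D = g ` Q"
        using rep D unfolding D_def unimod_class_def by fastforce
      note gm = GL_facet_mutation[OF g(1) Q F'(1), folded g(2)]
      have "head ?G (D, g ` F') = unimod_class N (g ` rep C)"
        using facet_graph_head[OF D gm(1) gm(2)[OF F'(2)]] gm(3)[OF F'(2)] F'(3) by simp
      also have "\<dots> = C" using unimod_class_image[OF g(1)] rep_class[OF C] by simp
      finally show "\<exists>e2\<in>arcs ?G. tail ?G e = head ?G e2 \<and> head ?G e = tail ?G e2"
        using D gm(1) hd by (intro bexI[of _ "(D, g ` F')"]) (auto simp: arcs tail e)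
    qed
  qed
qed

lemma facet_graph_out_degree:
  assumes C: "C \<in> mutation_class N P"
  shows "finite (out_arcs (facet_graph N P rep) C)" "out_degree (facet_graph N P rep) C = ad N P"
proof -
  have eq: "out_arcs (facet_graph N P rep) C = Pair C ` {F. admissible N (rep C) F}"
    using C by (auto simp: out_arcs_def facet_graph_def)
  show "finite (out_arcs (facet_graph N P rep) C)"
    unfolding eq using finite_admissible_facets[OF rep_fano[OF C]] by simp
  have "out_degree (facet_graph N P rep) C = ad N (rep C)"
    unfolding out_degree_def eq ad_def by (rule card_image) (auto intro: inj_onI)
  then show "out_degree (facet_graph N P rep) C = ad N P"
    using mutation_class_member(3)[OF P C] rep C by simp
qed

end

text \<open>Unimodular maps between the two representatives of each class match their facets.\<close>

lemma facet_graph_same_edges: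
  assumes P: "fano_simplex N P" and rep: "\<forall>C\<in>mutation_class N P. rep C \<in> C"
    and rep': "\<forall>C\<in>mutation_class N P. rep' C \<in> C"
  shows "same_edges (facet_graph N P rep) (facet_graph N P rep')"
proof -
  let ?G = "facet_graph N P rep" and ?H = "facet_graph N P rep'"
  have "\<exists>g\<in>GL N. rep' C = g ` rep C" if "C \<in> mutation_class N P" for C
  proof -
    have "rep' C \<in> unimod_class N (rep C)" using rep_class[OF P rep that] rep' that by simp
    then show ?thesis by (auto simp: unimod_class_def)
  qed
  then obtain g where g: "\<And>C. C \<in> mutation_class N P \<Longrightarrow> g C \<in> GL N \<and> rep' C = g C ` rep C" by metis
  define f where "f = (\<lambda>(C, F). (C, g C ` F))"
  have arcs: "arcs (facet_graph N P r) = Sigma (mutation_class N P) (\<lambda>C. {F. admissible N (r C) F})" for r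
    by (auto simp: facet_graph_def)
  have bij: "bij_betw ((`) (g C)) {F. admissible N (rep C) F} {F. admissible N (rep' C) F}"
    if "C \<in> mutation_class N P" for C
    using GL_admissible_bij[OF _ rep_fano[OF P rep that], of "g C"] g[OF that] by simp
  have "bij_betw f (arcs ?G) (arcs ?H)"
    unfolding bij_betw_def
  proof
    show "inj_on f (arcs ?G)"
      using bij unfolding arcs f_def bij_betw_def by (auto intro!: inj_onI dest: inj_onD)
    show "f ` arcs ?G = arcs ?H"
    proof (intro equalityI subsetI)
      fix e assume "e \<in> f ` arcs ?G"
      then obtain C F where "C \<in> mutation_class N P" "admissible N (rep C) F" "e = (C, g C ` F)"
        unfolding arcs f_def by auto
      then show "e \<in> arcs ?H" using bij_betw_apply[OF bij[of C], of F] unfolding arcs by simp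
    next
      fix e assume "e \<in> arcs ?H"
      then obtain C F' where C: "C \<in> mutation_class N P" "admissible N (rep' C) F'" "e = (C, F')"
        unfolding arcs by blast
      then obtain F where "admissible N (rep C) F" "F' = g C ` F"
        using bij_betw_imp_surj_on[OF bij[OF C(1)]] by blast
      then show "e \<in> f ` arcs ?G"
        using C unfolding arcs f_def by (intro image_eqI[of _ _ "(C, F)"]) auto
    qed
  qed
  moreover have "tail ?H (f e) = tail ?G e \<and> head ?H (f e) = head ?G e" if "e \<in> arcs ?G" for e
  proof -
    obtain C F where e: "e = (C, F)" and C: "C \<in> mutation_class N P" and F: "admissible N (rep C) F"
      using \<open>e \<in> arcs ?G\<close> unfolding arcs by blast
    obtain v where v: "v extreme_point_of F" using admissible_extreme_point[OF P rep rep_fano[OF P rep C] F] .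
    have gC: "g C \<in> GL N" "rep' C = g C ` rep C" using g[OF C] by auto
    note gm = GL_facet_mutation[OF gC(1) rep_fano[OF P rep C] F, folded gC(2)]
    have "head ?H (C, g C ` F) = head ?G (C, F)"
      unfolding facet_graph_head[OF P rep C F v] facet_graph_head[OF P rep' C gm(1) gm(2)[OF v]] gm(3)[OF v]
      by (rule unimod_class_image[OF gC(1)])
    then show ?thesis by (simp add: e f_def facet_graph_def)
  qed
  moreover have "verts ?G = verts ?H" by (simp add: facet_graph_def)
  ultimately show ?thesis unfolding same_edges_def by blast
qed

end

section \<open>Squarefree parts\<close>

lemma gcd_factorsE:
  fixes m k :: nat
  assumes "k > 0"
  obtains g m' k' where "m = g * m'" "k = g * k'" "coprime m' k'" "g > 0"
proof -
  have "gcd m k \<noteq> 0" using assms by simp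
  from gcd_coprime_exists[OF this] obtain m' k' where "m = m' * gcd m k" "k = k' * gcd m k" "coprime m' k'"
    by blast
  then show ?thesis using assms by (intro that[of "gcd m k" m' k']) (simp_all add: mult.commute)
qed

lemma squarefree_decomposition:
  fixes c \<rho> :: nat
  assumes c: "squarefree c" and \<rho>: "\<rho> > 0"
  shows "square_part (c * \<rho>\<^sup>2) = \<rho>" "squarefree_part (c * \<rho>\<^sup>2) = c"
proof -
  show sq: "square_part (c * \<rho>\<^sup>2) = \<rho>"
  proof -
    have "x dvd \<rho>" if x: "x\<^sup>2 dvd c * \<rho>\<^sup>2" for x
    proof -
      obtain g x' \<rho>' where g: "x = g * x'" "\<rho> = g * \<rho>'" "coprime x' \<rho>'" "g > 0"
        using gcd_factorsE[OF \<rho>, of x] .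
      have "g\<^sup>2 * x'\<^sup>2 dvd g\<^sup>2 * (c * \<rho>'\<^sup>2)" using x by (simp add: g power_mult_distrib mult_ac)
      then have "x'\<^sup>2 dvd c * \<rho>'\<^sup>2" using g(4) by simp
      moreover have "coprime (x'\<^sup>2) (\<rho>'\<^sup>2)" using g(3) by simp
      ultimately have "x'\<^sup>2 dvd c" by (simp add: coprime_dvd_mult_left_iff)
      then have "x' = 1" using squarefreeD[OF c] by simp
      then show ?thesis using g by simp
    qed
    then have "x dvd square_part (c * \<rho>\<^sup>2) \<longleftrightarrow> x dvd \<rho>" for x
      by (auto simp: dvd_square_part_iff)
    then show ?thesis by (metis dvd_antisym dvd_refl)
  qed
  show "squarefree_part (c * \<rho>\<^sup>2) = c"
    using squarefree_decompose[of "c * \<rho>\<^sup>2"] \<rho> unfolding sq by simp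
qed

lemma squarefree_dvd_power2:
  fixes c \<tau> :: nat
  assumes c: "squarefree c" and d: "c dvd \<tau>\<^sup>2"
  shows "c dvd \<tau>"
proof -
  have c0: "c > 0" using c by (cases c) auto
  obtain g \<tau>' c' where g: "\<tau> = g * \<tau>'" "c = g * c'" "coprime \<tau>' c'" "g > 0"
    using gcd_factorsE[OF c0, of \<tau>] .
  have "g * c' dvd g * (g * \<tau>'\<^sup>2)" using d by (simp add: g power_mult_distrib power2_eq_square mult_ac)
  then have "c' dvd g * \<tau>'\<^sup>2" using g(4) by simp
  moreover have "coprime c' (\<tau>'\<^sup>2)" using g(3) by (simp add: coprime_commute)
  ultimately have "c' dvd g" by (simp add: coprime_dvd_mult_left_iff)
  then have "c'\<^sup>2 dvd c" unfolding g(2) power2_eq_square by (intro mult_dvd_mono) auto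
  then have "c' = 1" using squarefreeD[OF c] by simp
  then show ?thesis using g by simp
qed

text \<open>With \<open>w = c a\<^sup>2\<close> the quotient is \<open>c (\<sigma> / (c a))\<^sup>2\<close>. It is an integer and \<open>c\<close> is squarefree, so
  \<open>\<sigma> / (c a)\<close> is an integer as well.\<close>

lemma squarefree_parts_quotient:
  fixes w \<sigma> :: nat
  assumes w: "w > 0" "w dvd \<sigma>\<^sup>2" and \<sigma>: "\<sigma> > 0"
  shows "squarefree_part (\<sigma>\<^sup>2 div w) = squarefree_part w"
    and "square_part (\<sigma>\<^sup>2 div w) * (squarefree_part w * square_part w) = \<sigma>"
proof -
  define c a where "c = squarefree_part w" and "a = square_part w"
  have c: "squarefree c" by (simp add: c_def)
  have wca: "w = c * a\<^sup>2" unfolding c_def a_def by (rule squarefree_decompose)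
  have pos: "c > 0" "a > 0" using w(1) unfolding wca by auto
  have "a\<^sup>2 dvd \<sigma>\<^sup>2" using w(2) wca dvd_mult_right by blast
  then have "a dvd \<sigma>" by simp
  then obtain \<tau> where \<tau>: "\<sigma> = a * \<tau>" by blast
  obtain q where q: "\<sigma>\<^sup>2 = w * q" using w(2) by blast
  have tq: "\<tau>\<^sup>2 = c * q" using q pos unfolding wca \<tau> by (simp add: power_mult_distrib)
  then have "c dvd \<tau>" using squarefree_dvd_power2[OF c] by simp
  then obtain \<rho> where \<rho>: "\<tau> = c * \<rho>" by blast
  have "q = c * \<rho>\<^sup>2" using tq pos unfolding \<rho> by (simp add: power2_eq_square mult_ac)
  moreover have "\<sigma>\<^sup>2 div w = q" using q w(1) by simp
  ultimately have "\<sigma>\<^sup>2 div w = c * \<rho>\<^sup>2" by simp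
  then show "squarefree_part (\<sigma>\<^sup>2 div w) = squarefree_part w"
    "square_part (\<sigma>\<^sup>2 div w) * (squarefree_part w * square_part w) = \<sigma>"
    using squarefree_decomposition[OF c, of \<rho>] \<tau> \<rho> \<sigma> by (simp_all add: c_def[symmetric] a_def[symmetric])
qed

section \<open>Weights\<close>

text \<open>After division by \<open>gcd m k\<close> a Bezout relation exhibits \<open>r\<close> as a multiple of \<open>k / gcd m k\<close>.\<close>

lemma primitive_multiple_dvd:
  assumes N: "full_lattice N" and r: "primitive_in N r" and z: "z \<in> N"
    and eq: "real m *\<^sub>R r = real k *\<^sub>R z" and k: "k > 0"
  shows "k dvd m"
proof -
  obtain g m' k' where g: "m = g * m'" "k = g * k'" "coprime m' k'" "g > 0"
    using gcd_factorsE[OF k, of m] .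
  have eq': "real m' *\<^sub>R r = real k' *\<^sub>R z"
  proof -
    have "real g *\<^sub>R (real m' *\<^sub>R r) = real g *\<^sub>R (real k' *\<^sub>R z)" using eq by (simp add: g)
    then show ?thesis using g(4) by (subst (asm) scaleR_cancel_left) auto
  qed
  have "gcd (int m') (int k') = 1" using g(3) by (simp add: coprime_iff_gcd_eq_1)
  then obtain u v where uv: "u * int m' + v * int k' = 1" by (metis bezout_int)
  then have "real_of_int u * real m' + real_of_int v * real k' = 1"
    by (metis of_int_1 of_int_add of_int_mult of_int_of_nat_eq)
  then have "r = (of_int u * real m' + of_int v * real k') *\<^sub>R r" by simp
  also have "\<dots> = of_int u *\<^sub>R (real m' *\<^sub>R r) + of_int v *\<^sub>R (real k' *\<^sub>R r)" by (simp add: scaleR_add_left)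
  also have "\<dots> = real k' *\<^sub>R (of_int u *\<^sub>R z + of_int v *\<^sub>R r)"
    unfolding eq' by (simp add: scaleR_add_right mult.commute)
  finally have "r = real k' *\<^sub>R (of_int u *\<^sub>R z + of_int v *\<^sub>R r)" .
  moreover have "of_int u *\<^sub>R z + of_int v *\<^sub>R r \<in> N"
    using z r by (intro lattice_add[OF N] lattice_scale[OF N]) (auto simp: primitive_in_def)
  ultimately have "k' = 1" using r unfolding primitive_in_def by blast
  then show ?thesis using g by simp
qed

context fano_vertices
begin

text \<open>The barycentric coordinates, rescaled to coprime integers. It is shown below that these are the
  weights of the simplex.\<close>

definition weight_vector :: "('a \<Rightarrow> nat) \<Rightarrow> bool" where
  "weight_vector b \<longleftrightarrow> (\<exists>s>0. \<forall>x\<in>V. real (b x) = s * \<beta> x) \<and> Gcd (b ` V) = 1"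

lemma weight_vector_pos: "weight_vector b \<Longrightarrow> x \<in> V \<Longrightarrow> b x > 0"
  using pos unfolding weight_vector_def by (metis mult_pos_pos of_nat_0_less_iff)

lemma weight_vector_relation:
  assumes "weight_vector b" "p \<in> V"
  shows "real (b p) *\<^sub>R p = - (\<Sum>x\<in>V - {p}. real (b x) *\<^sub>R x)"
proof -
  obtain s where s: "\<And>x. x \<in> V \<Longrightarrow> real (b x) = s * \<beta> x" using assms by (auto simp: weight_vector_def)
  have "(\<Sum>x\<in>V. real (b x) *\<^sub>R x) = s *\<^sub>R (\<Sum>x\<in>V. \<beta> x *\<^sub>R x)"
    by (simp add: s scaleR_sum_right)
  then have "real (b p) *\<^sub>R p + (\<Sum>x\<in>V - {p}. real (b x) *\<^sub>R x) = 0"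
    using sum.remove[OF fin assms(2), of "\<lambda>x. real (b x) *\<^sub>R x"] bary by simp
  then show ?thesis by (simp add: eq_neg_iff_add_eq_0)
qed

lemma weight_vector_ratio:
  assumes "weight_vector b" "p \<in> V"
  shows "real (\<Sum>x\<in>V - {p}. b x) = ratio p * real (b p)"
proof -
  obtain s where s: "\<And>x. x \<in> V \<Longrightarrow> real (b x) = s * \<beta> x" using assms by (auto simp: weight_vector_def)
  have "real (\<Sum>x\<in>V - {p}. b x) = s * (1 - \<beta> p)"
    by (simp add: s sum_distrib_left[symmetric] sum_beta_facet assms)
  also have "\<dots> = ratio p * (s * \<beta> p)" using ratio_beta[OF assms(2)] by simp
  finally show ?thesis unfolding s[OF assms(2)] .
qed

text \<open>Some positive multiple of a vertex is an integral combination of the others, and this relation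
  is proportional to the barycentric one.\<close>

lemma weight_vector_exists: "\<exists>b. weight_vector b"
proof -
  obtain p where p: "p \<in> V" using card_V fin by fastforce
  have sub: "V - {p} \<subseteq> N" "finite (V - {p})" "p \<in> N" using V_sub fin p by auto
  obtain k :: nat where k: "k > 0" "real k *\<^sub>R p \<in> int_span (V - {p})"
    using lattice_torsion[OF lattice sub(2,1) span_facet[OF p] sub(3)] by blast
  obtain c :: "'a \<Rightarrow> int" where c: "real k *\<^sub>R p = (\<Sum>x\<in>V - {p}. of_int (c x) *\<^sub>R x)"
    using k(2) by (auto simp: int_span_def)
  define e where "e x = (if x = p then int k else - c x)" for x
  define s where "s = (\<Sum>x\<in>V. real_of_int (e x))"
  have "(\<Sum>x\<in>V. real_of_int (e x) *\<^sub>R x) = real k *\<^sub>R p + (\<Sum>x\<in>V - {p}. - (of_int (c x) *\<^sub>R x))"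
    using p by (simp add: sum.remove[OF fin p] e_def)
  also have "\<dots> = 0" unfolding c by (simp add: sum_negf)
  finally have rel: "real_of_int (e x) = s * \<beta> x" if "x \<in> V" for x
    unfolding s_def using relation_multiple[of "\<lambda>x. real_of_int (e x)"] that by blast
  have s0: "s > 0"
    using rel[OF p] k(1) pos[OF p] by (simp add: e_def) (metis of_nat_0_less_iff zero_less_mult_pos2)
  define a where "a x = nat (e x)" for x
  have ea: "real (a x) = s * \<beta> x" if "x \<in> V" for x
  proof -
    have "real_of_int (e x) > 0" using rel[OF that] s0 pos[OF that] by simp
    then show ?thesis using rel[OF that] by (simp add: a_def)
  qed
  define g where "g = Gcd (a ` V)"
  have "a p > 0" using k by (simp add: a_def e_def)
  moreover have "g dvd a p" using p by (simp add: g_def)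
  ultimately have g0: "g > 0" by (rule dvd_pos_nat)
  define b where "b x = a x div g" for x
  have ab: "a x = g * b x" if "x \<in> V" for x using that by (simp add: b_def g_def)
  have "Gcd (b ` V) = 1"
  proof -
    have "g * Gcd (b ` V) dvd Gcd (a ` V)"
      by (intro Gcd_greatest) (auto simp: ab intro!: mult_dvd_mono)
    then have "g * Gcd (b ` V) dvd g * 1" by (simp add: g_def)
    then have "Gcd (b ` V) dvd 1" using g0 by (simp only: nat_mult_dvd_cancel1)
    then show ?thesis by simp
  qed
  moreover have "real (b x) = (s / real g) * \<beta> x" if "x \<in> V" for x
    using ea[OF that] g0 unfolding ab[OF that] by (simp add: field_simps)
  ultimately have "weight_vector b"
    unfolding weight_vector_def using s0 g0 by (auto intro!: exI[of _ "s / real g"])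
  then show ?thesis by blast
qed

text \<open>A common divisor of the weights other than that of \<open>p\<close> divides a multiple of the primitive
  vector \<open>p\<close>, hence the remaining weight as well.\<close>

lemma weight_well_formed:
  assumes b: "weight_vector b" and p: "p \<in> V" and d: "\<And>x. x \<in> V - {p} \<Longrightarrow> d dvd b x"
  shows "d = 1"
proof -
  obtain q where q: "q \<in> V - {p}" using facet_ne[OF p] by blast
  have d0: "d > 0" using dvd_pos_nat[OF _ d[OF q]] weight_vector_pos[OF b] q by simp
  let ?z = "- (\<Sum>x\<in>V - {p}. real (b x div d) *\<^sub>R x)"
  have "(\<Sum>x\<in>V - {p}. real (b x div d) *\<^sub>R x) \<in> N"
    using V_sub by (intro lattice_sum[OF lattice] lattice_scale[OF lattice]) auto
  then have "?z \<in> N" using lattice_scale[OF lattice, of "-1"] by fastforce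
  moreover have "real (b p) *\<^sub>R p = real d *\<^sub>R ?z"
    unfolding weight_vector_relation[OF b p] scaleR_minus_right scaleR_sum_right
    using d by (auto intro!: sum.cong simp flip: of_nat_mult)
  ultimately have "d dvd b p" using primitive_multiple_dvd[OF lattice prim[OF p]] d0 by blast
  then have "d dvd Gcd (b ` V)" using d by (intro Gcd_greatest) auto
  then show ?thesis using b by (simp add: weight_vector_def)
qed

text \<open>With \<open>\<lambda>\<close> the weight of \<open>p\<close>, the relation between the vertices reads
  \<open>\<lambda> p + \<sigma> r \<in> d N\<close> since the facet is admissible. Multiplying by \<open>\<sigma>\<close> turns this into
  \<open>\<sigma>\<^sup>2 r \<in> \<lambda> N\<close>, and \<open>r\<close> is primitive.\<close>

lemma weight_dvd_square:
  assumes b: "weight_vector b" and p: "p \<in> V" "adm p"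
  shows "b p dvd (\<Sum>x\<in>V - {p}. b x)\<^sup>2"
proof -
  obtain r where r: "r \<in> V - {p}" using facet_ne[OF p(1)] by blast
  define \<sigma> where "\<sigma> = (\<Sum>x\<in>V - {p}. b x)"
  define h where "h = ratio p * of_int (fdist p)"
  have h: "h \<in> \<int>" using height_eq_int[OF p(1)] unfolding h_def by (metis Ints_of_int)
  have "\<exists>g. g \<in> N \<and> x - r = of_int (fdist p) *\<^sub>R g" if "x \<in> V - {p}" for x
    using mut_edge_lattice[OF p(1) r p(2) that] by metis
  then obtain g where g: "\<And>x. x \<in> V - {p} \<Longrightarrow> g x \<in> N \<and> x - r = of_int (fdist p) *\<^sub>R g x" by metis
  define G where "G = (\<Sum>x\<in>V - {p}. real (b x) *\<^sub>R g x)"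
  have G: "G \<in> N" unfolding G_def using g by (intro lattice_sum[OF lattice] lattice_scale[OF lattice]) auto
  have "(\<Sum>x\<in>V - {p}. real (b x) *\<^sub>R x) = (\<Sum>x\<in>V - {p}. real (b x) *\<^sub>R r + of_int (fdist p) *\<^sub>R (real (b x) *\<^sub>R g x))"
  proof (intro sum.cong refl)
    fix x assume "x \<in> V - {p}"
    then have "x = r + of_int (fdist p) *\<^sub>R g x" using g by (metis add.commute diff_add_cancel)
    then have "real (b x) *\<^sub>R x = real (b x) *\<^sub>R (r + of_int (fdist p) *\<^sub>R g x)" by simp
    then show "real (b x) *\<^sub>R x = real (b x) *\<^sub>R r + of_int (fdist p) *\<^sub>R (real (b x) *\<^sub>R g x)"
      by (simp add: scaleR_add_right mult.commute)
  qed
  also have "\<dots> = real \<sigma> *\<^sub>R r + of_int (fdist p) *\<^sub>R G"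
    by (simp add: sum.distrib scaleR_sum_left scaleR_sum_right \<sigma>_def G_def)
  finally have "real \<sigma> *\<^sub>R r = - (real (b p) *\<^sub>R p) - of_int (fdist p) *\<^sub>R G"
    unfolding weight_vector_relation[OF b p(1)] by simp
  \<comment> \<open>The factor \<open>\<sigma>\<close> makes the last summand divisible by \<open>\<lambda>\<close>, since \<open>\<sigma> d = \<lambda> h\<close>.\<close>
  then have "real (\<sigma>\<^sup>2) *\<^sub>R r = real \<sigma> *\<^sub>R (- (real (b p) *\<^sub>R p) - of_int (fdist p) *\<^sub>R G)"
    by (simp add: power2_eq_square flip: scaleR_scaleR)
  also have "\<dots> = real (b p) *\<^sub>R (- real \<sigma> *\<^sub>R p) - (real \<sigma> * of_int (fdist p)) *\<^sub>R G"
    by (simp add: scaleR_diff_right mult.commute)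
  also have "real \<sigma> * of_int (fdist p) = real (b p) * h"
    using weight_vector_ratio[OF b p(1)] by (simp add: \<sigma>_def h_def)
  finally have "real (\<sigma>\<^sup>2) *\<^sub>R r = real (b p) *\<^sub>R (- real \<sigma> *\<^sub>R p - h *\<^sub>R G)"
    by (simp add: scaleR_diff_right)
  moreover have "- real \<sigma> *\<^sub>R p - h *\<^sub>R G \<in> N"
    using G h V_sub p by (intro lattice_diff[OF lattice] lattice_scale[OF lattice]) auto
  ultimately show ?thesis
    using primitive_multiple_dvd[OF lattice prim[of r]] r weight_vector_pos[OF b p(1)] unfolding \<sigma>_def by blast
qed

text \<open>The new tuple is proportional to the new barycentric coordinates, and it is coprime because
  already the weights that do not change are.\<close>

lemma mut_weight_vector:
  assumes b: "weight_vector b" and p: "p \<in> V" "adm p" and r: "r \<in> V - {p}"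
    and b': "\<And>x. x \<in> V \<Longrightarrow> b' (mut p r x) = (if x = p then (\<Sum>x\<in>V - {p}. b x)\<^sup>2 div b p else b x)"
  shows "fano_vertices.weight_vector (mut p r ` V) (mut_beta p r) b'"
proof -
  interpret M: fano_vertices N "mut p r ` V" "mut_beta p r" by (rule mut_fano[OF p(1) r p(2)])
  let ?\<sigma> = "\<Sum>x\<in>V - {p}. b x"
  obtain s where s: "s > 0" "\<And>x. x \<in> V \<Longrightarrow> real (b x) = s * \<beta> x" using b by (auto simp: weight_vector_def)
  have t: "ratio p > 0" by (rule ratio_pos[OF p(1)])
  have "real (?\<sigma>\<^sup>2 div b p) = (real ?\<sigma>)\<^sup>2 / real (b p)"
    using weight_dvd_square[OF b p] by (simp add: real_of_nat_div)
  also have "\<dots> = ratio p * (ratio p * real (b p))"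
    unfolding weight_vector_ratio[OF b p(1)] using weight_vector_pos[OF b p(1)] by (simp add: power2_eq_square)
  also have "\<dots> = (s * ratio p) * (1 - \<beta> p)"
    using ratio_beta[OF p(1)] s(2)[OF p(1)] by simp
  finally have "real (b' y) = (s * ratio p) * mut_beta p r y" if "y \<in> mut p r ` V" for y
    using that t s(2) b' mut_beta_mut[OF p(1) r] by auto
  moreover have "Gcd (b' ` mut p r ` V) = 1"
  proof (rule weight_well_formed[OF b p(1)])
    fix x assume x: "x \<in> V - {p}"
    then have "Gcd (b' ` mut p r ` V) dvd b' (mut p r x)" by (intro Gcd_dvd) blast
    then show "Gcd (b' ` mut p r ` V) dvd b x" using b' x by simp
  qed
  ultimately show ?thesis unfolding M.weight_vector_def using s(1) t by (metis mult_pos_pos)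
qed

text \<open>The vertex \<open>p\<close> has order \<open>b p\<close> modulo the span of the opposite facet: a relation expressing
  \<open>k p\<close> is \<open>k / b p\<close> times the coprime one, so \<open>b p\<close> divides \<open>k b x\<close> for every vertex \<open>x\<close>.\<close>

lemma facet_order:
  assumes b: "weight_vector b" and p: "p \<in> V" and k: "of_int k *\<^sub>R p \<in> int_span (V - {p})"
  shows "int (b p) dvd k"
proof -
  obtain c :: "'a \<Rightarrow> int" where c: "of_int k *\<^sub>R p = (\<Sum>x\<in>V - {p}. of_int (c x) *\<^sub>R x)"
    using k by (auto simp: int_span_def)
  define e where "e x = (if x = p then k else - c x)" for x
  define \<tau> where "\<tau> = (\<Sum>x\<in>V. real_of_int (e x))"
  have "(\<Sum>x\<in>V. real_of_int (e x) *\<^sub>R x) = of_int k *\<^sub>R p + (\<Sum>x\<in>V - {p}. - (of_int (c x) *\<^sub>R x))"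
    using p by (simp add: sum.remove[OF fin p] e_def)
  also have "\<dots> = 0" unfolding c by (simp add: sum_negf)
  finally have rel: "real_of_int (e x) = \<tau> * \<beta> x" if "x \<in> V" for x
    unfolding \<tau>_def using relation_multiple[of "\<lambda>x. real_of_int (e x)"] that by blast
  obtain s where s: "\<And>x. x \<in> V \<Longrightarrow> real (b x) = s * \<beta> x" using b by (auto simp: weight_vector_def)
  have "b p dvd nat \<bar>k\<bar> * b x" if x: "x \<in> V" for x
  proof -
    have "real_of_int (k * int (b x)) = real_of_int (int (b p) * e x)"
      using rel[OF x] rel[OF p] s[OF x] s[OF p] by (simp add: e_def)
    then have "k * int (b x) = int (b p) * e x" by (simp only: of_int_eq_iff)
    then have "int (b p) dvd k * int (b x)" by simp
    then have "b p dvd nat \<bar>k * int (b x)\<bar>" by (simp add: dvd_nat_abs_iff)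
    then show ?thesis by (simp add: nat_abs_mult_distrib)
  qed
  then have "b p dvd Gcd ((*) (nat \<bar>k\<bar>) ` (b ` V))" by (intro Gcd_greatest) auto
  then have "b p dvd nat \<bar>k\<bar>" using b by (simp add: Gcd_mult weight_vector_def)
  then show ?thesis by (simp add: dvd_nat_abs_iff)
qed

text \<open>The span of all vertices modulo the span of a facet is cyclic, generated by the opposite
  vertex, and \<open>facet_order\<close> gives its order.\<close>

lemma facet_index_eq:
  assumes b: "weight_vector b" and p: "p \<in> V"
  shows "lattice_index N (int_span (V - {p})) = lattice_index N (int_span V) * b p"
proof -
  let ?L = "int_span (V - {p})" and ?L' = "int_span V"
  let ?R = "coset_rel N ?L" and ?R' = "coset_rel N ?L'"
  have eqv: "equiv N ?R" "equiv N ?R'" using equiv_coset_rel[OF lattice] by auto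
  have mult: "int_span (V - {p}) \<subseteq> int_span V"
    unfolding int_span_eq
  proof clarify
    fix c :: "'a \<Rightarrow> real" assume c: "\<forall>x\<in>V - {p}. c x \<in> \<int>"
    let ?c = "\<lambda>x. if x = p then 0 else c x"
    have "(\<Sum>x\<in>V - {p}. c x *\<^sub>R x) = (\<Sum>x\<in>V. ?c x *\<^sub>R x)" by (simp add: sum.remove[OF fin p])
    with c show "\<exists>d. (\<Sum>x\<in>V - {p}. c x *\<^sub>R x) = (\<Sum>x\<in>V. d x *\<^sub>R x) \<and> (\<forall>x\<in>V. d x \<in> \<int>)"
      by (intro exI[of _ ?c]) auto
  qed
  have pL': "of_int j *\<^sub>R p \<in> ?L'" for j by (intro int_span_scale int_span_base fin p) simp
  have pN: "of_int j *\<^sub>R p \<in> N" for j using V_sub p by (intro lattice_scale[OF lattice]) auto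
  have bp: "real (b p) *\<^sub>R p \<in> ?L"
  proof -
    have "(\<Sum>x\<in>V - {p}. real (b x) *\<^sub>R x) \<in> ?L"
      using fin by (intro int_span_sum int_span_scale int_span_base) auto
    then show ?thesis using int_span_scale[of "-1"] unfolding weight_vector_relation[OF b p] by force
  qed
  have rep: "\<exists>j<b p. y - real j *\<^sub>R p \<in> ?L" if y: "y \<in> ?L'" for y
  proof -
    obtain c :: "'a \<Rightarrow> int" where c: "y = (\<Sum>x\<in>V. of_int (c x) *\<^sub>R x)" using y by (auto simp: int_span_def)
    define j where "j = nat (c p mod int (b p))"
    have b0: "int (b p) > 0" using weight_vector_pos[OF b p] by simp
    have j: "int j = c p mod int (b p)" using b0 by (simp add: j_def)
    have "c p = int j + (c p div int (b p)) * int (b p)" unfolding j by simp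
    then have cj: "real_of_int (c p) = real j + of_int (c p div int (b p)) * real (b p)"
      by (metis of_int_add of_int_mult of_int_of_nat_eq)
    have "y = of_int (c p) *\<^sub>R p + (\<Sum>x\<in>V - {p}. of_int (c x) *\<^sub>R x)"
      unfolding c by (rule sum.remove[OF fin p])
    then have "y - real j *\<^sub>R p = of_int (c p div int (b p)) *\<^sub>R (real (b p) *\<^sub>R p) + (\<Sum>x\<in>V - {p}. of_int (c x) *\<^sub>R x)"
      unfolding cj by (simp add: scaleR_add_left)
    also have "\<dots> \<in> ?L"
    proof (rule int_span_add)
      show "of_int (c p div int (b p)) *\<^sub>R (real (b p) *\<^sub>R p) \<in> ?L" by (rule int_span_scale[OF _ bp]) simp
      show "(\<Sum>x\<in>V - {p}. of_int (c x) *\<^sub>R x) \<in> ?L" by (auto simp: int_span_def)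
    qed
    finally show ?thesis using j b0 by (intro exI[of _ j]) (metis of_nat_less_iff pos_mod_bound)
  qed
  define rp where "rp C = (SOME x. x \<in> C)" for C :: "'a set"
  have rp: "rp C \<in> N" "C = ?R' `` {rp C}" if C: "C \<in> N // ?R'" for C
  proof -
    have "C \<noteq> {}" using in_quotient_imp_non_empty[OF eqv(2) C] .
    then have r: "rp C \<in> C" unfolding rp_def by (simp add: some_in_eq)
    then show "rp C \<in> N" using in_quotient_imp_subset[OF eqv(2) C] by blast
    obtain y where y: "C = ?R' `` {y}" using C by (rule quotientE)
    have "(y, rp C) \<in> ?R'" using r unfolding y by simp
    from y equiv_class_eq[OF eqv(2) this] show "C = ?R' `` {rp C}" by (rule trans)
  qed
  \<comment> \<open>A coset of the smaller lattice is determined by the coset of the larger one that contains it,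
    and by the multiple of \<open>p\<close> that it is shifted by.\<close>
  let ?f = "\<lambda>(C, j). ?R `` {rp C + real j *\<^sub>R p}"
  have "bij_betw ?f ((N // ?R') \<times> {..<b p}) (N // ?R)"
    unfolding bij_betw_def
  proof (intro conjI inj_onI equalityI subsetI)
    fix u v assume u: "u \<in> (N // ?R') \<times> {..<b p}" and v: "v \<in> (N // ?R') \<times> {..<b p}" and eq: "?f u = ?f v"
    obtain C j where u': "u = (C, j)" "C \<in> N // ?R'" "j < b p" using u by auto
    obtain D k where v': "v = (D, k)" "D \<in> N // ?R'" "k < b p" using v by auto
    have mem: "rp C + real j *\<^sub>R p \<in> N" "rp D + real k *\<^sub>R p \<in> N"
      using rp(1) u'(2) v'(2) pN[of "int j"] pN[of "int k"] lattice_add[OF lattice] by auto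
    have "(rp C + real j *\<^sub>R p, rp D + real k *\<^sub>R p) \<in> ?R"
      using eq_equiv_class[OF _ eqv(1) mem(2)] eq u' v' by simp
    then have L: "rp C - rp D + of_int (int j - int k) *\<^sub>R p \<in> ?L" by (simp add: coset_rel_def algebra_simps)
    then have "rp C - rp D + of_int (int j - int k) *\<^sub>R p - of_int (int j - int k) *\<^sub>R p \<in> ?L'"
      using mult L pL'[of "int j - int k"] by (intro int_span_diff) blast+
    then have "(rp C, rp D) \<in> ?R'" using rp(1) u'(2) v'(2) by (simp add: coset_rel_def)
    then have CD: "C = D" using rp(2)[OF u'(2)] rp(2)[OF v'(2)] equiv_class_eq[OF eqv(2)] by metis
    then have "of_int (int j - int k) *\<^sub>R p \<in> ?L" using L by simp
    then have "int (b p) dvd int j - int k" by (rule facet_order[OF b p])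
    then have "int j mod int (b p) = int k mod int (b p)" by (simp add: mod_eq_dvd_iff)
    then have "j = k" using u'(3) v'(3) by simp
    then show "u = v" using CD u' v' by simp
  next
    fix Y assume "Y \<in> ?f ` ((N // ?R') \<times> {..<b p})"
    then obtain C j where "C \<in> N // ?R'" "Y = ?R `` {rp C + real j *\<^sub>R p}" by auto
    then show "Y \<in> N // ?R"
      using rp(1) pN[of "int j"] lattice_add[OF lattice] by (auto intro!: quotientI)
  next
    fix Y assume "Y \<in> N // ?R"
    then obtain y where y: "y \<in> N" "Y = ?R `` {y}" by (rule quotientE)
    define C where "C = ?R' `` {y}"
    have C: "C \<in> N // ?R'" unfolding C_def using y(1) by (rule quotientI)
    have "?R' `` {y} = ?R' `` {rp C}" using rp(2)[OF C] by (simp add: C_def)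
    then have "y - rp C \<in> ?L'"
      using eq_equiv_class[OF _ eqv(2) rp(1)[OF C]] by (auto simp: coset_rel_def)
    then obtain j where j: "j < b p" "y - rp C - real j *\<^sub>R p \<in> ?L" using rep by blast
    then have "(y, rp C + real j *\<^sub>R p) \<in> ?R"
      using y(1) rp(1)[OF C] pN[of "int j"] lattice_add[OF lattice] by (auto simp: coset_rel_def algebra_simps)
    then have "Y = ?f (C, j)" using y(2) equiv_class_eq[OF eqv(1)] by simp
    then show "Y \<in> ?f ` ((N // ?R') \<times> {..<b p})" using C j(1) by blast
  qed
  from bij_betw_same_card[OF this] show ?thesis
    by (simp add: lattice_index_eq card_cartesian_product)
qed

lemma lattice_index_pos: "lattice_index N (int_span V) > 0"
proof -
  obtain p where p: "p \<in> V" using card_V fin by fastforce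
  have "span V = UNIV" using span_facet[OF p] span_mono[of "V - {p}" V] by auto
  then have "finite (N // coset_rel N (int_span V))" by (rule finite_index[OF lattice fin V_sub])
  moreover have "N // coset_rel N (int_span V) \<noteq> {}" using lattice_zero[OF lattice] quotientI by blast
  ultimately show ?thesis by (simp add: lattice_index_eq card_gt_0_iff)
qed

lemma weight_eq:
  assumes b: "weight_vector b" and vs: "set vs = V" and i: "i < length vs"
  shows "weight N vs i = b (vs ! i)"
proof -
  let ?m = "lattice_index N (int_span V)"
  have fi: "facet_index N vs j = ?m * b (vs ! j)" if "j < length vs" for j
    unfolding facet_index_def vs using facet_index_eq[OF b, of "vs ! j"] that vs by auto
  have "facet_index N vs ` {..<length vs} = (*) ?m ` (b ` V)"
    using vs by (force simp: fi image_image set_conv_nth)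
  then have "simplex_mult N vs = ?m" using b by (simp add: simplex_mult_def Gcd_mult weight_vector_def)
  then show ?thesis using fi[OF i] lattice_index_pos by (simp add: weight_def)
qed

end

section \<open>Vieta involutions\<close>

context
  fixes k m :: nat and c :: "nat list"
  assumes cpos: "\<And>j. j < length c \<Longrightarrow> c ! j > 0" and len: "length c \<ge> 2"
begin

lemma vieta_sum_pos:
  assumes x: "x \<in> pos_sols (k, m, c)" and i: "i < length x"
  shows "(\<Sum>j\<in>{..<length x} - {i}. real (c ! j) * (x ! j)\<^sup>2) > 0"
proof (rule sum_pos)
  have l: "length x = length c" using x by (simp add: pos_sols_def)
  have "card ({..<length x} - {i}) > 0" using i len l by simp
  then show "{..<length x} - {i} \<noteq> {}" by fastforce
  fix j assume j: "j \<in> {..<length x} - {i}"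
  then have "x ! j > 0" using x by (auto simp: pos_sols_def)
  then show "real (c ! j) * (x ! j)\<^sup>2 > 0" using cpos[of j] j l by simp
qed simp

text \<open>The new entry is the second root of the equation as a quadratic equation in one variable: with
  \<open>S\<close> the sum of the other terms, \<open>c x\<^sup>2 + S\<close> divided by \<open>x\<close> is symmetric in the two roots \<open>x\<close> and \<open>y\<close>,
  since \<open>c x y = S\<close>.\<close>

lemma vieta_pos_sols:
  assumes x: "x \<in> pos_sols (k, m, c)" and i: "i < length x"
  shows "vieta (k, m, c) i x \<in> pos_sols (k, m, c)" "vieta (k, m, c) i (vieta (k, m, c) i x) = x"
proof -
  define S where "S = (\<Sum>j\<in>{..<length x} - {i}. real (c ! j) * (x ! j)\<^sup>2)"
  define A where "A = (\<Prod>j\<in>{..<length x} - {i}. x ! j)"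
  define y where "y = S / (real (c ! i) * x ! i)"
  have l: "length x = length c" using x by (simp add: pos_sols_def)
  have xi: "x ! i > 0" using x i by (auto simp: pos_sols_def)
  have ci: "real (c ! i) > 0" using cpos i l by simp
  have S: "S > 0" unfolding S_def by (rule vieta_sum_pos[OF x i])
  have y: "y > 0" using S xi ci by (simp add: y_def)
  have v: "vieta (k, m, c) i x = x[i := y]" by (simp add: y_def S_def)
  have S': "(\<Sum>j\<in>{..<length x} - {i}. real (c ! j) * (x[i := z] ! j)\<^sup>2) = S" for z
    unfolding S_def by (intro sum.cong) auto
  have A': "(\<Prod>j\<in>{..<length x} - {i}. x[i := z] ! j) = A" for z
    unfolding A_def by (intro prod.cong) auto
  have sums: "(\<Sum>j<length x. real (c ! j) * (x[i := z] ! j)\<^sup>2) = real (c ! i) * z\<^sup>2 + S"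
    "(\<Prod>j<length x. x[i := z] ! j) = z * A" for z
    using i S' A' by (simp_all add: sum.remove[of "{..<length x}" i] prod.remove[of "{..<length x}" i])
  have "real k * (real (c ! i) * (x ! i)\<^sup>2 + S) = real m * (x ! i * A)"
    using x sums[of "x ! i"] l by (simp add: pos_sols_def)
  then have eq: "real k * (real (c ! i) * (x ! i)\<^sup>2 + S) * (y / x ! i) = real m * (y * A)"
    using xi by simp
  have yx: "real (c ! i) * y * x ! i = S" using ci xi by (simp add: y_def)
  have "(real (c ! i) * (x ! i)\<^sup>2 + S) * (y / x ! i) = real (c ! i) * y * x ! i + real (c ! i) * y\<^sup>2"
    using xi unfolding yx[symmetric] by (simp add: field_simps power2_eq_square)
  also have "\<dots> = real (c ! i) * y\<^sup>2 + S" unfolding yx by simp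
  finally have "real k * (real (c ! i) * y\<^sup>2 + S) = real m * (y * A)"
    using eq by (simp only: mult.assoc)
  then show "vieta (k, m, c) i x \<in> pos_sols (k, m, c)"
    unfolding v pos_sols_def using x y l sums[of y] by (auto simp: pos_sols_def dest!: set_update_subset_insert[THEN subsetD])
  have "vieta (k, m, c) i (vieta (k, m, c) i x) = x[i := S / (real (c ! i) * y)]"
    unfolding v using i S' by simp
  also have "S / (real (c ! i) * y) = x ! i" using yx ci y by (simp add: field_simps)
  finally show "vieta (k, m, c) i (vieta (k, m, c) i x) = x" by simp
qed

lemma solution_graph_sym: "sym_digraph (solution_graph (k, m, c))"
proof (unfold_locales, goal_cases)
  case (1 e) then show ?case by (auto simp: solution_graph_def)
next
  case (2 e)
  then show ?case using vieta_pos_sols(1) by (auto simp: solution_graph_def pos_int_sols_def simp del: vieta.simps)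
next
  case 3
  show ?case unfolding symmetric_conv
  proof
    fix e assume "e \<in> arcs (solution_graph (k, m, c))"
    then obtain x i where e: "e = (x, i)" "x \<in> pos_sols (k, m, c)" "set x \<subseteq> \<int>" "i < length x"
        "set (vieta (k, m, c) i x) \<subseteq> \<int>"
      by (auto simp: solution_graph_def pos_int_sols_def simp del: vieta.simps)
    let ?y = "vieta (k, m, c) i x"
    have len: "length ?y = length x" by simp
    note v = vieta_pos_sols[OF e(2,4)]
    show "\<exists>e2\<in>arcs (solution_graph (k, m, c)). tail (solution_graph (k, m, c)) e = head (solution_graph (k, m, c)) e2 \<and>
         head (solution_graph (k, m, c)) e = tail (solution_graph (k, m, c)) e2"
      using e v len
      by (intro bexI[of _ "(?y, i)"]) (auto simp: solution_graph_def pos_int_sols_def simp del: vieta.simps)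
  qed
qed

end

section \<open>The Markov-type equation of a Fano simplex\<close>

lemma reduced_fraction_unique:
  fixes s p s' p' :: nat
  assumes "s > 0" "p > 0" "s' > 0" "p' > 0" and eq: "s' * p = s * p'"
  shows "(p' div gcd s' p', s' div gcd s' p') = (p div gcd s p, s div gcd s p)"
proof -
  obtain g a b where g: "s = g * a" "p = g * b" "coprime a b" "g > 0" by (rule gcd_factorsE[OF assms(2)])
  obtain g' a' b' where g': "s' = g' * a'" "p' = g' * b'" "coprime a' b'" "g' > 0" by (rule gcd_factorsE[OF assms(4)])
  have "g * g' * (a' * b) = g * g' * (a * b')" using eq unfolding g g' by (simp add: mult_ac)
  then have "a' * b = a * b'" using g(4) g'(4) by simp
  then have "a' = a \<and> b' = b"
    using coprime_crossproduct_nat[of a' b' a b] g(3) g'(3) by (simp add: coprime_commute mult.commute)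
  moreover have "gcd s p = g" "gcd s' p' = g'"
    unfolding g g' using g(3) g'(3) by (simp_all add: gcd_mult_distrib_nat[symmetric])
  ultimately show ?thesis using g g' by simp
qed

context fano_vertices
begin

lemma length_labelling:
  assumes "labelling (convex hull V) vs" shows "set vs = V" "distinct vs" "length vs = DIM('a) + 1"
  using assms card_V distinct_card[of vs] by (auto simp: labelling_def extreme_point_hull)

lemma tuples:
  assumes vs: "labelling (convex hull V) vs" and j: "j < length vs"
  shows "c_tuple N vs ! j > 0" "a_tuple N vs ! j > 0"
    and "c_tuple N vs ! j * (a_tuple N vs ! j)\<^sup>2 = weight N vs j"
proof -
  obtain b where b: "weight_vector b" using weight_vector_exists by blast
  have "weight N vs j > 0"
    using weight_eq[OF b length_labelling(1)[OF vs] j] weight_vector_pos[OF b] length_labelling(1)[OF vs] j by auto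
  then have "square_part (weight N vs j) > 0" by (metis neq0_conv square_part_0_iff)
  then show "c_tuple N vs ! j > 0" "a_tuple N vs ! j > 0"
    using j by (simp_all add: c_tuple_def a_tuple_def) (metis neq0_conv squarefree_part_nonzero)
  show "c_tuple N vs ! j * (a_tuple N vs ! j)\<^sup>2 = weight N vs j"
    using j squarefree_decompose[of "weight N vs j"] by (simp add: c_tuple_def a_tuple_def)
qed

lemma DE_shape:
  assumes vs: "labelling (convex hull V) vs"
  obtains k m where "DE N vs = (k, m, c_tuple N vs)" "length (c_tuple N vs) \<ge> 2"
    "\<And>j. j < length (c_tuple N vs) \<Longrightarrow> c_tuple N vs ! j > 0"
proof -
  have l: "length (c_tuple N vs) = length vs" by (simp add: c_tuple_def)
  show ?thesis
  proof (rule that)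
    show "DE N vs = (fst (DE N vs), fst (snd (DE N vs)), c_tuple N vs)" by (simp add: DE_def Let_def)
    show "length (c_tuple N vs) \<ge> 2"
      using length_labelling(3)[OF vs] DIM_positive[where 'a='a] unfolding l by linarith
    show "c_tuple N vs ! j > 0" if "j < length (c_tuple N vs)" for j
      using that tuples(1)[OF vs] unfolding l by blast
  qed
qed

lemma a_tuple_solution:
  assumes vs: "labelling (convex hull V) vs"
  shows "map real (a_tuple N vs) \<in> pos_int_sols (DE N vs)"
proof -
  let ?c = "c_tuple N vs" and ?a = "a_tuple N vs"
  let ?s = "\<Sum>j<length vs. ?c ! j * (?a ! j)\<^sup>2" and ?p = "\<Prod>j<length vs. ?a ! j"
  have l: "length ?a = length vs" "length ?c = length vs" by (simp_all add: a_tuple_def c_tuple_def)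
  have "(p div gcd s p) * s = (s div gcd s p) * p" for s p :: nat
    by (simp only: dvd_div_mult[OF gcd_dvd1] dvd_div_mult[OF gcd_dvd2] mult.commute[of p s])
  then have "(?p div gcd ?s ?p) * ?s = (?s div gcd ?s ?p) * ?p" .
  then have "real (?p div gcd ?s ?p) * real ?s = real (?s div gcd ?s ?p) * real ?p"
    by (simp only: flip: of_nat_mult)
  then have "solves (DE N vs) (map real ?a)"
    unfolding DE_def Let_def solves.simps using l by simp
  moreover have "x > 0" if "x \<in> set ?a" for x
    using that tuples(2)[OF vs] l by (auto simp: in_set_conv_nth)
  ultimately show ?thesis by (auto simp: pos_int_sols_def pos_sols_def)
qed

lemma induced_labelling_eq:
  assumes vs: "labelling (convex hull V) vs" and i: "i < length vs" and r: "r < length vs" "r \<noteq> i"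
  shows "induced_labelling N (convex hull V) vs i r = map (mut (vs ! i) (vs ! r)) vs"
proof -
  note V = length_labelling[OF vs]
  have p: "vs ! i \<in> V" using V i by auto
  have t: "h_max N (convex hull V) (opp_facet vs i) / of_int (facet_dist N (convex hull V) (opp_facet vs i)) = ratio (vs ! i)"
    using h_max_eq[OF p] fdist_pos[OF p] by (simp add: opp_facet_def V)
  have "vs ! j = vs ! i \<longleftrightarrow> j = i" if "j < length vs" for j using that i V(2) by (simp add: nth_eq_iff_index_eq)
  then show ?thesis
    unfolding induced_labelling_def Let_def t using r
    by (intro nth_equalityI) (auto simp: mut_def)
qed

lemma mut_labelling:
  assumes vs: "labelling (convex hull V) vs" and p: "p \<in> V" "adm p" and r: "r \<in> V - {p}"
  shows "labelling (convex hull (mut p r ` V)) (map (mut p r) vs)"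
proof -
  interpret M: fano_vertices N "mut p r ` V" "mut_beta p r" by (rule mut_fano[OF p(1) r p(2)])
  show ?thesis
    using length_labelling(1,2)[OF vs] mut_inj[OF p(1) r] by (simp add: labelling_def M.extreme_point_hull distinct_map)
qed

text \<open>The description of the weights through the vertex set, transferred to labels.\<close>

lemma weight_mut:
  assumes vs: "labelling (convex hull V) vs" and i: "i < length vs" "adm (vs ! i)"
    and r: "r \<in> V - {vs ! i}" and j: "j < length vs"
  shows "weight N (map (mut (vs ! i) r) vs) j =
    (if j = i then (\<Sum>l\<in>{..<length vs} - {i}. weight N vs l)\<^sup>2 div weight N vs i else weight N vs j)"
    and "weight N vs i dvd (\<Sum>l\<in>{..<length vs} - {i}. weight N vs l)\<^sup>2"
proof -
  note V = length_labelling[OF vs]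
  let ?p = "vs ! i"
  have p: "?p \<in> V" using V i by auto
  interpret M: fano_vertices N "mut ?p r ` V" "mut_beta ?p r" by (rule mut_fano[OF p r i(2)])
  obtain b where b: "weight_vector b" using weight_vector_exists by blast
  have w: "weight N vs l = b (vs ! l)" if "l < length vs" for l by (rule weight_eq[OF b V(1) that])
  have bij: "bij_betw ((!) vs) ({..<length vs} - {i}) (V - {?p})"
    using bij_betw_DiffI[OF bij_betw_nth[OF V(2) refl V(1)[symmetric]], of "{i}" "{?p}"] i p by simp
  have "(\<Sum>l\<in>{..<length vs} - {i}. weight N vs l) = (\<Sum>l\<in>{..<length vs} - {i}. b (vs ! l))"
    by (intro sum.cong) (auto simp: w)
  also have "\<dots> = (\<Sum>x\<in>V - {?p}. b x)" by (rule sum.reindex_bij_betw[OF bij])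
  finally have \<sigma>: "(\<Sum>l\<in>{..<length vs} - {i}. weight N vs l) = (\<Sum>x\<in>V - {?p}. b x)" .
  show "weight N vs i dvd (\<Sum>l\<in>{..<length vs} - {i}. weight N vs l)\<^sup>2"
    unfolding \<sigma> w[OF i(1)] by (rule weight_dvd_square[OF b p i(2)])
  define b' where "b' y = (let x = the_inv_into V (mut ?p r) y in if x = ?p then (\<Sum>x\<in>V - {?p}. b x)\<^sup>2 div b ?p else b x)" for y
  have b': "b' (mut ?p r x) = (if x = ?p then (\<Sum>x\<in>V - {?p}. b x)\<^sup>2 div b ?p else b x)" if "x \<in> V" for x
    using the_inv_into_f_f[OF mut_inj[OF p r] that] by (simp add: b'_def)
  have "M.weight_vector b'" by (rule mut_weight_vector[OF b p i(2) r b'])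
  from M.weight_eq[OF this, of "map (mut ?p r) vs" j]
  have "weight N (map (mut ?p r) vs) j = b' (mut ?p r (vs ! j))" using V j by simp
  also have "vs ! j \<in> V" using V j by auto
  note b'[OF this]
  also have "vs ! j = ?p \<longleftrightarrow> j = i" using V(2) i j by (simp add: nth_eq_iff_index_eq)
  finally show "weight N (map (mut ?p r) vs) j =
    (if j = i then (\<Sum>l\<in>{..<length vs} - {i}. weight N vs l)\<^sup>2 div weight N vs i else weight N vs j)"
    unfolding \<sigma> w[OF i(1)] w[OF j] .
qed

text \<open>By the quotient rule for squarefree parts the square parts undergo the Vieta involution with
  unchanged coefficients. The equation is then determined by the quotient of the sum and
  the product, and that is the same for both solutions.\<close>

lemma DE_mut:
  assumes vs: "labelling (convex hull V) vs" and i: "i < length vs" "adm (vs ! i)"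
    and r: "r \<in> V - {vs ! i}"
  shows "DE N (map (mut (vs ! i) r) vs) = DE N vs"
    and "map real (a_tuple N (map (mut (vs ! i) r) vs)) = vieta (DE N vs) i (map real (a_tuple N vs))"
proof -
  let ?vs = "map (mut (vs ! i) r) vs"
  define c where "c = c_tuple N vs"
  define a where "a = a_tuple N vs"
  define \<alpha> where "\<alpha> = a_tuple N ?vs ! i"
  define \<sigma> where "\<sigma> = (\<Sum>l\<in>{..<length vs} - {i}. weight N vs l)"
  note V = length_labelling[OF vs]
  have p: "vs ! i \<in> V" using V i by auto
  interpret M: fano_vertices N "mut (vs ! i) r ` V" "mut_beta (vs ! i) r" by (rule mut_fano[OF p r i(2)])
  have vs': "labelling (convex hull (mut (vs ! i) r ` V)) ?vs" by (rule mut_labelling[OF vs p i(2) r])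
  note W = weight_mut[OF vs i r]
  have w0: "weight N vs l > 0" if "l < length vs" for l
    using tuples[OF vs that] by (metis nat_0_less_mult_iff zero_less_power)
  have "\<sigma> > 0"
    unfolding \<sigma>_def
  proof (rule sum_pos)
    have "card ({..<length vs} - {i}) > 0" using i V(3) DIM_positive[where 'a='a] by simp
    then show "{..<length vs} - {i} \<noteq> {}" by fastforce
  qed (use w0 in auto)
  note sq = squarefree_parts_quotient[OF w0[OF i(1)] W(2)[OF i(1), folded \<sigma>_def] this]
  have l: "length a = length vs" "length c = length vs" by (simp_all add: a_def c_def a_tuple_def c_tuple_def)
  have c': "c_tuple N ?vs = c"
    unfolding c_def c_tuple_def using sq(1) W(1) by (auto simp: \<sigma>_def)
  have \<alpha>: "\<alpha> * (c ! i * a ! i) = \<sigma>"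
    unfolding \<alpha>_def c_def a_def using sq(2) W(1) i(1) by (simp add: a_tuple_def c_tuple_def \<sigma>_def)
  have a': "a_tuple N ?vs = a[i := \<alpha>]"
    by (rule nth_equalityI) (auto simp: a_def \<alpha>_def a_tuple_def W(1) nth_list_update)
  have \<sigma>: "\<sigma> = (\<Sum>j\<in>{..<length vs} - {i}. c ! j * (a ! j)\<^sup>2)"
    unfolding \<sigma>_def c_def a_def by (intro sum.cong) (auto simp: tuples(3)[OF vs])
  define A where "A = (\<Prod>j\<in>{..<length vs} - {i}. a ! j)"
  have sums: "(\<Sum>j<length vs. c ! j * (a[i := z] ! j)\<^sup>2) = c ! i * z\<^sup>2 + \<sigma>"
    "(\<Prod>j<length vs. a[i := z] ! j) = z * A" for z
    using i l by (auto simp: sum.remove[of "{..<length vs}" i] prod.remove[of "{..<length vs}" i] \<sigma> A_def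
        intro!: sum.cong prod.cong)
  have pos: "c ! i > 0" "a ! i > 0" "\<alpha> > 0" "A > 0" "\<sigma> > 0"
    using tuples[OF vs] M.tuples(2)[OF vs', of i] i \<open>\<sigma> > 0\<close>
    by (auto simp: c_def a_def \<alpha>_def A_def intro!: prod_pos)
  have cross: "(c ! i * \<alpha>\<^sup>2 + \<sigma>) * (a ! i * A) = (c ! i * (a ! i)\<^sup>2 + \<sigma>) * (\<alpha> * A)"
    unfolding \<alpha>[symmetric] by (simp add: algebra_simps power2_eq_square)
  have "DE N ?vs = (let s = c ! i * \<alpha>\<^sup>2 + \<sigma>; p = \<alpha> * A in (p div gcd s p, s div gcd s p, c))"
    unfolding DE_def Let_def c' a' length_map sums ..
  moreover have "DE N vs = (let s = c ! i * (a ! i)\<^sup>2 + \<sigma>; p = a ! i * A in (p div gcd s p, s div gcd s p, c))"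
    unfolding DE_def Let_def c_def[symmetric] a_def[symmetric] using sums[of "a ! i"] by simp
  ultimately show "DE N ?vs = DE N vs"
    using reduced_fraction_unique[OF _ _ _ _ cross] pos by (simp add: Let_def)
  obtain k m where E: "DE N vs = (k, m, c)" using DE_shape[OF vs] unfolding c_def by blast
  have "real \<alpha> * (real (c ! i) * real (a ! i)) = real \<sigma>" unfolding \<alpha>[symmetric] by simp
  then have "real \<alpha> = real \<sigma> / (real (c ! i) * real (a ! i))" using pos by (simp add: field_simps)
  also have "real \<sigma> = (\<Sum>j\<in>{..<length vs} - {i}. real (c ! j) * (map real a ! j)\<^sup>2)"
    unfolding \<sigma> of_nat_sum using l by (intro sum.cong) auto
  finally show "map real (a_tuple N ?vs) = vieta (DE N vs) i (map real (a_tuple N vs))"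
    unfolding E a' a_def[symmetric] using l i by (simp add: map_update)
qed

end

theorem theorem1p1:
  fixes N P :: "'a::euclidean_space set"
  assumes "full_lattice N" and "fano_simplex N P"
  shows
    "(\<forall>F v. admissible N P F \<and> v extreme_point_of F \<longrightarrow>
        fano_simplex N (facet_mutation N P F v) \<and> ad N (facet_mutation N P F v) = ad N P) \<and>
     (\<forall>C\<in>mutation_class N P. \<forall>R\<in>C. fano_simplex N R) \<and>
     (\<forall>rep. (\<forall>C\<in>mutation_class N P. rep C \<in> C) \<longrightarrow>
        sym_digraph (facet_graph N P rep) \<and>
        (\<forall>C\<in>mutation_class N P.
           finite (out_arcs (facet_graph N P rep) C) \<and>
           out_degree (facet_graph N P rep) C = ad N P) \<and>
        (\<forall>rep'. (\<forall>C\<in>mutation_class N P. rep' C \<in> C) \<longrightarrow>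
           same_edges (facet_graph N P rep) (facet_graph N P rep'))) \<and>

     (\<forall>vs. labelling P vs \<longrightarrow>
        (\<forall>i<length vs. \<forall>r<length vs. r \<noteq> i \<and> admissible N P (opp_facet vs i) \<longrightarrow>
           labelling (facet_mutation N P (opp_facet vs i) (vs ! r)) (induced_labelling N P vs i r) \<and>
           DE N (induced_labelling N P vs i r) = DE N vs) \<and>
        (\<forall>x\<in>pos_sols (DE N vs). \<forall>i<length x.
           vieta (DE N vs) i x \<in> pos_sols (DE N vs) \<and>
           vieta (DE N vs) i (vieta (DE N vs) i x) = x) \<and>
        sym_digraph (solution_graph (DE N vs))) \<and>

     (\<forall>vs. labelling P vs \<longrightarrow>
        map real (a_tuple N vs) \<in> pos_int_sols (DE N vs) \<and>
        (\<forall>i<length vs. \<forall>r<length vs. r \<noteq> i \<and> admissible N P (opp_facet vs i) \<longrightarrow>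
           (DE N (induced_labelling N P vs i r), map real (a_tuple N (induced_labelling N P vs i r)))
             = (DE N vs, vieta (DE N vs) i (map real (a_tuple N vs)))))"
proof -
  obtain V \<beta> where V: "fano_vertices N V \<beta>" "P = convex hull V"
    using fano_simplexE[OF assms] by blast
  interpret fano_vertices N V \<beta> by fact
  have mutation: "labelling (facet_mutation N P (opp_facet vs i) (vs ! r)) (induced_labelling N P vs i r)"
      "DE N (induced_labelling N P vs i r) = DE N vs"
      "map real (a_tuple N (induced_labelling N P vs i r)) = vieta (DE N vs) i (map real (a_tuple N vs))"
    if vs: "labelling P vs" and i: "i < length vs" and r: "r < length vs" "r \<noteq> i"
      and F: "admissible N P (opp_facet vs i)" for vs i r
  proof -
    note vs' = vs[unfolded V(2)]
    note L = length_labelling[OF vs']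
    have p: "vs ! i \<in> V" and r': "vs ! r \<in> V - {vs ! i}"
      using L i r by (auto simp: nth_eq_iff_index_eq)
    have opp: "opp_facet vs i = convex hull (V - {vs ! i})" by (simp add: opp_facet_def L)
    have a: "adm (vs ! i)" using F unfolding V(2) opp admissible_facet_iff[OF p] .
    show "labelling (facet_mutation N P (opp_facet vs i) (vs ! r)) (induced_labelling N P vs i r)"
      "DE N (induced_labelling N P vs i r) = DE N vs"
      "map real (a_tuple N (induced_labelling N P vs i r)) = vieta (DE N vs) i (map real (a_tuple N vs))"
      unfolding V(2) induced_labelling_eq[OF vs' i r] opp facet_mutation_eq[OF p r']
      by (rule mut_labelling[OF vs' p a r'] DE_mut[OF vs' i a r'])+
  qed
  have equation: "(\<forall>x\<in>pos_sols (DE N vs). \<forall>i<length x. vieta (DE N vs) i x \<in> pos_sols (DE N vs) \<and>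
        vieta (DE N vs) i (vieta (DE N vs) i x) = x) \<and> sym_digraph (solution_graph (DE N vs))"
    if "labelling P vs" for vs
  proof -
    obtain k m where E: "DE N vs = (k, m, c_tuple N vs)" and c: "length (c_tuple N vs) \<ge> 2"
        "\<And>j. j < length (c_tuple N vs) \<Longrightarrow> c_tuple N vs ! j > 0"
      using DE_shape \<open>labelling P vs\<close> unfolding V(2) by metis
    show ?thesis
      unfolding E using vieta_pos_sols[OF c(2,1), of _ k m] solution_graph_sym[OF c(2,1), of k m] by blast
  qed
  have solution: "map real (a_tuple N vs) \<in> pos_int_sols (DE N vs)" if "labelling P vs" for vs
    using a_tuple_solution that unfolding V(2) .
  show ?thesis
    by (intro conjI allI impI ballI; (elim conjE)?;
        (rule fano_simplex_facet_mutation[OF assms] mutation_class_member(1)[OF assms]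
          facet_graph_sym[OF assms] facet_graph_out_degree[OF assms] facet_graph_same_edges[OF assms]
          mutation equation[THEN conjunct1, rule_format, THEN conjunct1]
          equation[THEN conjunct1, rule_format, THEN conjunct2] equation[THEN conjunct2] solution
          arg_cong2[where f = Pair, OF mutation(2,3)]; assumption))
qed

end
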